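(* Let $\underline{\rho}>0$, $\underline{a}>0$, $\underline{\mathbf{u}}=(\underline{u}_1,\underline{u}_2)\in\mathbb{R}^2$ with $\underline{u}_1\neq0$, $\underline{u}_2\neq0$, and let $b^{(2)}_1,b^{(2)}_2,b^{(2)}_3$ be the constants defined in the context, associated with a first order IMEX-RK scheme with at most two stages. Assume $b^{(2)}_1<0$ and $b^{(2)}_3>0$. Then there exists a constant $C>0$, depending only on $\underline{\mathbf{u}}$, $\underline{a}$ and $b^{(2)}_1,b^{(2)}_2,b^{(2)}_3$ (in particular independent of $\varepsilon$), such that for every $\varepsilon>0$, all $\Delta x_1,\Delta x_2>0$ and all $\Delta t\in(0,C\min(\Delta x_1,\Delta x_2)]$, every solution $(\rho,\mathbf{u})\in C^1([0,\infty);H^2(\mathbb{T}^2)^3)$ of the modified equation below satisfies $\frac{d}{dt}E(t)\le0$, where $E=\frac{\underline{a}^2}{\underline{\rho}\varepsilon^2}\|\rho\|_{L^2}^2+\underline{\rho}\|\mathbf{u}\|_{L^2}^2$. The modified equation is $$\partial_t\begin{pmatrix}\rho\\ \mathbf{u}\end{pmatrix}+(\underline{\mathbf{u}}\cdot\nabla)\begin{pmatrix}\rho\\ \mathbf{u}\end{pmatrix}+\begin{pmatrix}\underline{\rho}\nabla\cdot\mathbf{u}\\ \frac{\underline{a}^2}{\underline{\rho}\varepsilon^2}\nabla\rho\end{pmatrix}=\mathcal{B}^{(2)}\begin{pmatrix}\rho\\ \mathbf{u}\end{pmatrix}$$ on $\mathbb{T}^2$, with $\mathcal{B}^{(2)}$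 as in the context.
   Context: For an IMEX-RK scheme with coefficients $\tilde a_{k,j},a_{k,j}$, weights $\tilde\omega_k,\omega_k$, $\tilde c_k=\sum_{j<k}\tilde a_{k,j}$, $c_k=\sum_{j\le k}a_{k,j}$ (with at most two stages, missing entries taken as zero): $b^{(2)}_1=\tilde\omega_2\tilde c_2-\frac12$, $b^{(2)}_2=\tilde\omega_1c_1+\tilde\omega_2c_2+\omega_2\tilde c_2-1$, $b^{(2)}_3=\omega_1c_1+\omega_2c_2-\frac12$. Operator $\mathcal{B}^{(2)}$ (first row scalar, second row vector valued), with $D=\underline{\mathbf{u}}\cdot\nabla$: $\mathcal{B}^{(2)}_{1,1}=\Delta t\big(b^{(2)}_1D^2+b^{(2)}_3\frac{\underline{a}^2}{\varepsilon^2}\Delta\big)+\frac12\sum_{k=1}^2\Delta x_k|\underline{u}_k|\partial_{x_k}^2$, $\mathcal{B}^{(2)}_{1,2}=\Delta t\,\underline{\rho}\,b^{(2)}_2D\nabla\cdot$, $\mathcal{B}^{(2)}_{2,1}=\Delta t\frac{\underline{a}^2}{\underline{\rho}\varepsilon^2}b^{(2)}_2D\nabla$, $\mathcal{B}^{(2)}_{2,2}=\Delta t\big(b^{(2)}_1D^2+b^{(2)}_3\frac{\underline{a}^2}{\varepsilon^2}\nabla\nabla\cdot\big)+\frac12\sum_{k=1}^2\Delta x_k|\underline{u}_k|\partial_{x_k}^2\mathbb{I}_2$. This is the modified equation of the fully-discrete (Rusanov/central flux) first order IMEX-RK scheme applied to the linear wave system $\partial_t\rho+D\rho+\underline{\rho}\nabla\cdot\mathbf{u}=0$,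 $\partial_t\mathbf{u}+D\mathbf{u}+\frac{\underline{a}^2}{\underline{\rho}\varepsilon^2}\nabla\rho=0$. *)

theory Defs
  imports "HOL-Analysis.Analysis"
begin

text \<open>Functions on the torus are represented by 1-periodic functions on R^2 (points as pairs).
  Spatial index i = 1 (x_1 direction) or i = 2 (x_2 direction).\<close>

definition Tbox :: "(real \<times> real) set" where
  "Tbox = cbox (0,0) (1,1)"

definition periodic2 :: "(real \<times> real \<Rightarrow> real) \<Rightarrow> bool" where
  "periodic2 f \<longleftrightarrow> (\<forall>x y. f (x + 1, y) = f (x, y) \<and> f (x, y + 1) = f (x, y))"

definition intT :: "(real \<times> real \<Rightarrow> real) \<Rightarrow> real" where
  "intT f = (LINT x:Tbox|lebesgue. f x)"

definition L2T :: "(real \<times> real \<Rightarrow> real) \<Rightarrow> bool" where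
  "L2T f \<longleftrightarrow> periodic2 f \<and> f \<in> borel_measurable lebesgue
      \<and> set_integrable lebesgue Tbox (\<lambda>x. (f x)^2)"

definition L2normT :: "(real \<times> real \<Rightarrow> real) \<Rightarrow> real" where
  "L2normT f = sqrt (intT (\<lambda>x. (f x)^2))"

definition C1per_test ::
  "(real \<times> real \<Rightarrow> real) \<Rightarrow> (real \<times> real \<Rightarrow> real) \<Rightarrow> (real \<times> real \<Rightarrow> real) \<Rightarrow> bool" where
  "C1per_test \<phi> p1 p2 \<longleftrightarrow> periodic2 \<phi> \<and> periodic2 p1 \<and> periodic2 p2
      \<and> continuous_on UNIV p1 \<and> continuous_on UNIV p2
      \<and> (\<forall>x. (\<phi> has_derivative (\<lambda>h. p1 x * fst h + p2 x * snd h)) (at x))"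

definition weak_pd :: "nat \<Rightarrow> (real \<times> real \<Rightarrow> real) \<Rightarrow> (real \<times> real \<Rightarrow> real) \<Rightarrow> bool" where
  "weak_pd i f g \<longleftrightarrow> (\<forall>\<phi> p1 p2. C1per_test \<phi> p1 p2 \<longrightarrow>
      intT (\<lambda>x. f x * (if i = 1 then p1 x else p2 x)) = - intT (\<lambda>x. g x * \<phi> x))"

definition pd :: "nat \<Rightarrow> (real \<times> real \<Rightarrow> real) \<Rightarrow> (real \<times> real \<Rightarrow> real)" where
  "pd i f = (SOME g. L2T g \<and> weak_pd i f g)"

definition d2 :: "nat \<Rightarrow> nat \<Rightarrow> (real \<times> real \<Rightarrow> real) \<Rightarrow> (real \<times> real \<Rightarrow> real)" where
  "d2 i j f = pd i (pd j f)"

definition H2T :: "(real \<times> real \<Rightarrow> real) \<Rightarrow> bool" where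
  "H2T f \<longleftrightarrow> L2T f \<and> (\<forall>i\<in>{1,2}. \<exists>g. L2T g \<and> weak_pd i f g)
      \<and> (\<forall>i\<in>{1,2}. \<forall>j\<in>{1,2}. \<exists>h. L2T h \<and> weak_pd j (pd i f) h)"

definition C1_L2 :: "(real \<Rightarrow> real \<times> real \<Rightarrow> real) \<Rightarrow> (real \<Rightarrow> real \<times> real \<Rightarrow> real) \<Rightarrow> bool" where
  "C1_L2 F G \<longleftrightarrow> (\<forall>t\<ge>0. L2T (F t) \<and> L2T (G t))
     \<and> (\<forall>t\<ge>0. ((\<lambda>s. L2normT (\<lambda>x. F s x - F t x - (s - t) * G t x) / \<bar>s - t\<bar>) \<longlongrightarrow> 0)
                 (at t within {0..}))
     \<and> (\<forall>t\<ge>0. ((\<lambda>s. L2normT (\<lambda>x. G s x - G t x)) \<longlongrightarrow> 0) (at t within {0..}))"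

text \<open>F is in C^1([0,oo); H^2(T^2)) with time derivative G (the H^2 norm is equivalent to
  the sum of the L^2 norms of all weak derivatives of order at most 2).\<close>
definition C1_H2 :: "(real \<Rightarrow> real \<times> real \<Rightarrow> real) \<Rightarrow> (real \<Rightarrow> real \<times> real \<Rightarrow> real) \<Rightarrow> bool" where
  "C1_H2 F G \<longleftrightarrow> (\<forall>t\<ge>0. H2T (F t) \<and> H2T (G t)) \<and> C1_L2 F G
     \<and> (\<forall>i\<in>{1,2}. C1_L2 (\<lambda>t. pd i (F t)) (\<lambda>t. pd i (G t)))
     \<and> (\<forall>i\<in>{1,2}. \<forall>j\<in>{1,2}. C1_L2 (\<lambda>t. d2 i j (F t)) (\<lambda>t. d2 i j (G t)))"

text \<open>Explicit part: at21 = tilde a_{2,1}; tilde c_1 = 0, tilde c_2 = at21.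
  Implicit part: a11, a21, a22; c_1 = a11, c_2 = a21 + a22.
  Weights: wt1, wt2 (explicit), w1, w2 (implicit).\<close>

definition imex_b1 :: "real \<Rightarrow> real \<Rightarrow> real" where
  "imex_b1 at21 wt2 = wt2 * at21 - 1/2"

definition imex_b2 :: "real \<Rightarrow> real \<Rightarrow> real \<Rightarrow> real \<Rightarrow> real \<Rightarrow> real \<Rightarrow> real \<Rightarrow> real" where
  "imex_b2 at21 a11 a21 a22 wt1 wt2 w2 = wt1 * a11 + wt2 * (a21 + a22) + w2 * at21 - 1"

definition imex_b3 :: "real \<Rightarrow> real \<Rightarrow> real \<Rightarrow> real \<Rightarrow> real \<Rightarrow> real" where
  "imex_b3 a11 a21 a22 w1 w2 = w1 * a11 + w2 * (a21 + a22) - 1/2"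

definition Dconv :: "real \<Rightarrow> real \<Rightarrow> (real \<times> real \<Rightarrow> real) \<Rightarrow> real \<times> real \<Rightarrow> real" where
  "Dconv u1 u2 f x = u1 * pd 1 f x + u2 * pd 2 f x"

definition Dconv2 :: "real \<Rightarrow> real \<Rightarrow> (real \<times> real \<Rightarrow> real) \<Rightarrow> real \<times> real \<Rightarrow> real" where
  "Dconv2 u1 u2 f x = u1 * u1 * d2 1 1 f x + u1 * u2 * d2 1 2 f x
                     + u2 * u1 * d2 2 1 f x + u2 * u2 * d2 2 2 f x"

definition lapT :: "(real \<times> real \<Rightarrow> real) \<Rightarrow> real \<times> real \<Rightarrow> real" where
  "lapT f x = d2 1 1 f x + d2 2 2 f x"

definition numvisc :: "real \<Rightarrow> real \<Rightarrow> real \<Rightarrow> real \<Rightarrow> (real \<times> real \<Rightarrow> real) \<Rightarrow> real \<times> real \<Rightarrow> real" where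
  "numvisc dx1 dx2 u1 u2 f x = 1/2 * (dx1 * \<bar>u1\<bar> * d2 1 1 f x + dx2 * \<bar>u2\<bar> * d2 2 2 f x)"

text \<open>Pointwise form of the modified equation at (t,x) for the unknowns r (density) and
  v1, v2 (velocity components) with time derivatives rt, v1t, v2t;
  parameters: rb = underline rho, a = underline a, u1, u2, eps, dt, dx1, dx2, b1, b2, b3.\<close>
definition modeq_at ::
  "real \<Rightarrow> real \<Rightarrow> real \<Rightarrow> real \<Rightarrow> real \<Rightarrow> real \<Rightarrow> real \<Rightarrow> real \<Rightarrow> real \<Rightarrow> real \<Rightarrow> real \<Rightarrow>
   (real \<times> real \<Rightarrow> real) \<Rightarrow> (real \<times> real \<Rightarrow> real) \<Rightarrow> (real \<times> real \<Rightarrow> real) \<Rightarrow>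
   (real \<times> real \<Rightarrow> real) \<Rightarrow> (real \<times> real \<Rightarrow> real) \<Rightarrow> (real \<times> real \<Rightarrow> real) \<Rightarrow> real \<times> real \<Rightarrow> bool" where
  "modeq_at rb a u1 u2 eps dt dx1 dx2 b1 b2 b3 r v1 v2 rt v1t v2t x \<longleftrightarrow>
    (let K = a^2 / (rb * eps^2); v = (\<lambda>m. if m = (1::nat) then v1 else v2);
         vt = (\<lambda>m. if m = (1::nat) then v1t else v2t) in
     rt x + Dconv u1 u2 r x + rb * (pd 1 v1 x + pd 2 v2 x)
       = dt * (b1 * Dconv2 u1 u2 r x + b3 * (a^2 / eps^2) * lapT r x)
         + numvisc dx1 dx2 u1 u2 r x
         + dt * rb * b2 * (u1 * (d2 1 1 v1 x + d2 1 2 v2 x) + u2 * (d2 2 1 v1 x + d2 2 2 v2 x))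
     \<and> (\<forall>m\<in>{1,2}.
         vt m x + Dconv u1 u2 (v m) x + K * pd m r x
           = dt * K * b2 * (u1 * d2 1 m r x + u2 * d2 2 m r x)
             + dt * (b1 * Dconv2 u1 u2 (v m) x + b3 * (a^2 / eps^2) * (d2 m 1 v1 x + d2 m 2 v2 x))
             + numvisc dx1 dx2 u1 u2 (v m) x))"

definition energy :: "real \<Rightarrow> real \<Rightarrow> real \<Rightarrow> (real \<times> real \<Rightarrow> real) \<Rightarrow> (real \<times> real \<Rightarrow> real)
    \<Rightarrow> (real \<times> real \<Rightarrow> real) \<Rightarrow> real" where
  "energy rb a eps r v1 v2 = a^2 / (rb * eps^2) * intT (\<lambda>x. (r x)^2)
      + rb * intT (\<lambda>x. (v1 x)^2 + (v2 x)^2)"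

end

theory Submission
  imports Defs
begin

text \<open>Testing the equation with the solution and integrating by parts turns half the energy
  derivative into minus a quadratic form in the gradients. With \<open>K = a\<^sup>2 / (\<rho> \<epsilon>\<^sup>2)\<close> and
  \<open>\<beta> = b2\<^sup>2 / (4 b3)\<close>, the two mixed terms are absorbed by Young's inequality: the one pairing
  \<open>D \<rho>\<close> with \<open>div u\<close> by the dissipation of \<open>div u\<close>, the one pairing \<open>D u\<close> with \<open>grad \<rho>\<close> by the
  dissipation of \<open>grad \<rho>\<close>. Each costs only \<open>\<beta> \<Delta>t\<close> times \<open>(D \<rho>)\<^sup>2\<close> or \<open>|D u|\<^sup>2\<close>, without any power of
  \<open>\<epsilon>\<close>, and together with the antidissipative \<open>b1\<close> terms these are dominated by the numerical
  viscosity as soon as \<open>4 (\<beta> - b1) |u\<^sub>k| \<Delta>t \<le> \<Delta>x\<^sub>k\<close>. No commutation of second weak derivatives is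
  needed.

  Integration by parts for two weakly differentiable functions rests on the essential
  skew-adjointness of the partial derivatives on trigonometric polynomials: \<open>u \<plusminus> \<partial>u = q\<close> is solvable
  there for every \<open>q\<close>, and trigonometric polynomials are dense in \<open>L\<^sup>2\<close>.\<close>

subsection \<open>Square-integrable functions\<close>

definition square_integrable :: "'a measure \<Rightarrow> ('a \<Rightarrow> real) \<Rightarrow> bool" where
  "square_integrable M f \<longleftrightarrow> f \<in> borel_measurable M \<and> integrable M (\<lambda>x. (f x)\<^sup>2)"

definition l2norm :: "'a measure \<Rightarrow> ('a \<Rightarrow> real) \<Rightarrow> real" where
  "l2norm M f = sqrt (\<integral>x. (f x)\<^sup>2 \<partial>M)"

lemma square_integrable_mult:
  assumes "square_integrable M f" "square_integrable M g"
  shows "integrable M (\<lambda>x. f x * g x)"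
proof (rule Bochner_Integration.integrable_bound)
  show "integrable M (\<lambda>x. (f x)\<^sup>2 + (g x)\<^sup>2)"
    using assms by (auto simp: square_integrable_def)
  show "(\<lambda>x. f x * g x) \<in> borel_measurable M"
    using assms by (auto simp: square_integrable_def)
  have "\<bar>a * b\<bar> \<le> a\<^sup>2 + b\<^sup>2" for a b :: real
  proof -
    have "2 * \<bar>a\<bar> * \<bar>b\<bar> \<le> a\<^sup>2 + b\<^sup>2"
      using sum_squares_bound[of "\<bar>a\<bar>" "\<bar>b\<bar>"] by simp
    moreover have "0 \<le> \<bar>a\<bar> * \<bar>b\<bar>" by simp
    ultimately show ?thesis unfolding abs_mult by linarith
  qed
  then show "AE x in M. norm (f x * g x) \<le> norm ((f x)\<^sup>2 + (g x)\<^sup>2)"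
    by simp
qed

lemma square_integrable_add:
  assumes "square_integrable M f" "square_integrable M g"
  shows "square_integrable M (\<lambda>x. f x + g x)"
proof -
  have "integrable M (\<lambda>x. (f x)\<^sup>2 + (g x)\<^sup>2 + 2 * (f x * g x))"
    using assms square_integrable_mult[OF assms] by (auto simp: square_integrable_def)
  then show ?thesis
    using assms by (auto simp: square_integrable_def power2_sum mult.assoc)
qed

lemma square_integrable_cmult:
  "square_integrable M f \<Longrightarrow> square_integrable M (\<lambda>x. c * f x)"
  by (auto simp: square_integrable_def power_mult_distrib)

lemma square_integrable_diff:
  assumes "square_integrable M f" "square_integrable M g"
  shows "square_integrable M (\<lambda>x. f x - g x)"
  using square_integrable_add[OF assms(1) square_integrable_cmult[OF assms(2), of "-1"]] by simp

lemma l2norm_nonneg [simp]: "l2norm M f \<ge> 0"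
  by (simp add: l2norm_def)

lemma l2norm_power2: "(l2norm M f)\<^sup>2 = (\<integral>x. (f x)\<^sup>2 \<partial>M)"
  by (simp add: l2norm_def)

lemma l2norm_cmult: "l2norm M (\<lambda>x. c * f x) = \<bar>c\<bar> * l2norm M f"
  by (simp add: l2norm_def power_mult_distrib real_sqrt_mult)

text \<open>The squared norm of \<open>s * f + t * g\<close> is a nonnegative quadratic form in
  \<open>(s, t)\<close>, so its discriminant has a sign.\<close>

lemma Cauchy_Schwarz_integral:
  assumes f: "square_integrable M f" and g: "square_integrable M g"
  shows "\<bar>\<integral>x. f x * g x \<partial>M\<bar> \<le> l2norm M f * l2norm M g"
proof -
  define A B I where "A = (\<integral>x. (f x)\<^sup>2 \<partial>M)" and "B = (\<integral>x. (g x)\<^sup>2 \<partial>M)"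
    and "I = (\<integral>x. f x * g x \<partial>M)"
  note int = f[unfolded square_integrable_def] g[unfolded square_integrable_def]
    square_integrable_mult[OF f g]
  have quad: "0 \<le> s\<^sup>2 * A + 2 * s * t * I + t\<^sup>2 * B" for s t
  proof -
    have "(\<integral>x. (s * f x + t * g x)\<^sup>2 \<partial>M)
        = (\<integral>x. s\<^sup>2 * (f x)\<^sup>2 + 2 * s * t * (f x * g x) + t\<^sup>2 * (g x)\<^sup>2 \<partial>M)"
      by (intro Bochner_Integration.integral_cong) (auto simp: power2_eq_square algebra_simps)
    also have "\<dots> = s\<^sup>2 * A + 2 * s * t * I + t\<^sup>2 * B"
      using int by (simp add: A_def B_def I_def)
    finally show ?thesis
      using Bochner_Integration.integral_nonneg[of M "\<lambda>x. (s * f x + t * g x)\<^sup>2"] by simp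
  qed
  have AB: "A \<ge> 0" "B \<ge> 0" by (simp_all add: A_def B_def)
  have "I\<^sup>2 \<le> A * B"
  proof (cases "A = 0")
    case True
    have "0 \<le> B + 2 * s * I" for s using quad[of s 1] True by simp
    \<comment> \<open>With \<open>A = 0\<close> the form is affine in \<open>s\<close>; this value
      of \<open>s\<close> would make it equal to -1 unless \<open>I = 0\<close>.\<close>
    from this[of "-(B+1)/(2*I)"] have "I = 0"
      by (cases "I = 0") (auto simp: field_simps)
    then show ?thesis using True by simp
  next
    case False
    have "0 \<le> A * (A * B - I\<^sup>2)"
      using quad[of "-I" A] by (simp add: power2_eq_square algebra_simps)
    then show ?thesis using False AB by (simp add: zero_le_mult_iff)
  qed
  then show ?thesis
    by (metis A_def B_def I_def l2norm_def real_sqrt_abs real_sqrt_le_iff real_sqrt_mult)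
qed

lemma l2norm_triangle:
  assumes f: "square_integrable M f" and g: "square_integrable M g"
  shows "l2norm M (\<lambda>x. f x + g x) \<le> l2norm M f + l2norm M g"
proof (rule power2_le_imp_le)
  have "(l2norm M (\<lambda>x. f x + g x))\<^sup>2
      = (\<integral>x. (f x)\<^sup>2 + (g x)\<^sup>2 + 2 * (f x * g x) \<partial>M)"
    by (simp add: l2norm_power2 power2_sum mult.assoc)
  also have "\<dots> = (l2norm M f)\<^sup>2 + (l2norm M g)\<^sup>2 + 2 * (\<integral>x. f x * g x \<partial>M)"
    using f g square_integrable_mult[OF f g] by (simp add: l2norm_power2 square_integrable_def)
  also have "\<dots> \<le> (l2norm M f + l2norm M g)\<^sup>2"
    using Cauchy_Schwarz_integral[OF f g] by (simp add: power2_sum)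
  finally show "(l2norm M (\<lambda>x. f x + g x))\<^sup>2 \<le> (l2norm M f + l2norm M g)\<^sup>2" .
qed simp

lemma l2norm_triangle_diff:
  assumes "square_integrable M f" "square_integrable M g"
  shows "l2norm M (\<lambda>x. f x - g x) \<le> l2norm M f + l2norm M g"
  using l2norm_triangle[OF assms(1) square_integrable_cmult[OF assms(2), of "-1"]]
    l2norm_cmult[of M "-1" g] by simp

lemma l2norm_uniform_bound:
  assumes "finite_measure M" "f \<in> borel_measurable M" "\<And>x. x \<in> space M \<Longrightarrow> \<bar>f x\<bar> \<le> c" "c \<ge> 0"
  shows "square_integrable M f" "l2norm M f \<le> c * sqrt (measure M (space M))"
proof -
  interpret finite_measure M by fact
  have b: "(f x)\<^sup>2 \<le> c\<^sup>2" if "x \<in> space M" for x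
    using power_mono[OF assms(3)[OF that] abs_ge_zero, of 2] by simp
  have i: "integrable M (\<lambda>x. (f x)\<^sup>2)"
    by (rule integrable_const_bound[where B="c\<^sup>2"]) (use assms b in auto)
  then show "square_integrable M f" using assms by (simp add: square_integrable_def)
  have "(\<integral>x. (f x)\<^sup>2 \<partial>M) \<le> (\<integral>x. c\<^sup>2 \<partial>M)"
    by (rule integral_mono) (use i b in auto)
  then have "l2norm M f \<le> sqrt (measure M (space M) * c\<^sup>2)" by (simp add: l2norm_def)
  then show "l2norm M f \<le> c * sqrt (measure M (space M))"
    using assms(4) by (simp add: real_sqrt_mult mult.commute)
qed

subsection \<open>Periodic test functions and trigonometric polynomials\<close>

text \<open>Lebesgue measure on the closed unit square: opposite edges are not identified, and
  periodicity is carried by the functions alone.\<close>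

abbreviation torus :: "(real \<times> real) measure" where
  "torus \<equiv> lebesgue_on Tbox"

lemma Tbox_lebesgue [simp]: "Tbox \<in> sets lebesgue"
  by (simp add: Tbox_def)

lemma intT_eq: "intT f = (\<integral>x. f x \<partial>torus)"
  by (simp add: intT_def set_lebesgue_integral_def integral_restrict_space)

lemma L2normT_eq: "L2normT f = l2norm torus f"
  by (simp add: L2normT_def l2norm_def intT_eq)

lemma L2T_square_integrable: "L2T f \<Longrightarrow> square_integrable torus f"
  by (simp add: L2T_def square_integrable_def set_integrable_def integrable_restrict_space
      measurable_restrict_space1)

lemma finite_measure_torus: "finite_measure torus"
  by (rule finite_measure_lebesgue_on) (simp add: Tbox_def)

lemma measure_torus: "measure torus Tbox = 1"
  by (simp add: measure_restrict_space Tbox_def content_Pair)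

lemma continuous_torus:
  fixes f :: "real \<times> real \<Rightarrow> real"
  assumes "continuous_on Tbox f"
  shows "integrable torus f" "square_integrable torus f"
proof -
  have *: "integrable torus h" if h: "continuous_on Tbox h" for h :: "real \<times> real \<Rightarrow> real"
  proof -
    have "set_integrable lebesgue Tbox h"
      using absolutely_integrable_continuous[of "(0,0)" "(1,1)" h] h by (simp add: Tbox_def)
    then show ?thesis by (simp add: set_integrable_def integrable_restrict_space)
  qed
  show "integrable torus f" "square_integrable torus f"
    using *[OF assms] *[of "\<lambda>x. (f x)\<^sup>2"] assms
    by (auto simp: square_integrable_def intro: continuous_intros)
qed

section \<open>Classical integration by parts for periodic C^1 functions\<close>

lemma C1per_has_derivative:
  "C1per_test \<phi> p1 p2 \<Longrightarrow> (\<phi> has_derivative (\<lambda>h. p1 x * fst h + p2 x * snd h)) (at x)"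
  unfolding C1per_test_def by blast

lemma C1per_continuous:
  assumes "C1per_test \<phi> p1 p2"
  shows "continuous_on S \<phi>" "continuous_on S p1" "continuous_on S p2"
proof -
  show "continuous_on S \<phi>"
    using has_derivative_continuous[OF C1per_has_derivative[OF assms]]
    by (blast intro: continuous_at_imp_continuous_on)
  show "continuous_on S p1" "continuous_on S p2"
    using assms continuous_on_subset unfolding C1per_test_def by blast+
qed

lemma C1per_mult:
  assumes "C1per_test f f1 f2" "C1per_test g g1 g2"
  shows "C1per_test (\<lambda>x. f x * g x) (\<lambda>x. f x * g1 x + f1 x * g x) (\<lambda>x. f x * g2 x + f2 x * g x)"
proof -
  note c = C1per_continuous[OF assms(1)] C1per_continuous[OF assms(2)]
  have "((\<lambda>x. f x * g x) has_derivative 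
     (\<lambda>h. (f x * g1 x + f1 x * g x) * fst h + (f x * g2 x + f2 x * g x) * snd h)) (at x)" for x
  proof -
    from has_derivative_mult[OF C1per_has_derivative[OF assms(1)] C1per_has_derivative[OF assms(2)]]
    show ?thesis
      by (rule has_derivative_eq_rhs) (auto simp: fun_eq_iff algebra_simps)
  qed
  then show ?thesis
    using assms c unfolding C1per_test_def periodic2_def
    by (intro conjI allI) (auto intro!: continuous_intros)
qed

text \<open>By Fubini and the fundamental theorem of calculus on each line parallel to an axis,
  where the two endpoint values agree by periodicity.\<close>

lemma C1per_integral_derivative:
  assumes t: "C1per_test \<phi> p1 p2"
  shows "intT p1 = 0" "intT p2 = 0"
proof -
  note c = C1per_continuous[OF t]
  note der = C1per_has_derivative[OF t]
  have per: "\<phi> (x + 1, y) = \<phi> (x, y)" "\<phi> (x, y + 1) = \<phi> (x, y)" for x y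
    using t by (auto simp: C1per_test_def periodic2_def)
  have eq: "intT p = integral (cbox (0,0) (1,1)) p" if "continuous_on UNIV p" for p
    using lebesgue_integral_eq_integral[of Tbox p] continuous_torus(1)[of p] that
    by (simp add: intT_eq Tbox_def[symmetric] continuous_on_subset)
  have d1: "((\<lambda>x. \<phi> (x, y)) has_vector_derivative p1 (x, y)) (at x within S)" for x y S
  proof -
    have "((\<lambda>x. \<phi> (x, y)) has_derivative (\<lambda>h. p1 (x,y) * fst (h, 0::real) + p2 (x,y) * snd (h, 0::real))) (at x)"
      by (rule has_derivative_compose[OF _ der, of "\<lambda>x. (x,y)"]) (auto intro!: derivative_eq_intros)
    then show ?thesis
      by (simp add: has_vector_derivative_def mult.commute has_derivative_at_withinI)
  qed
  have d2: "((\<lambda>y. \<phi> (x, y)) has_vector_derivative p2 (x, y)) (at y within S)" for x y S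
  proof -
    have "((\<lambda>y. \<phi> (x, y)) has_derivative (\<lambda>h. p1 (x,y) * fst (0::real, h) + p2 (x,y) * snd (0::real, h))) (at y)"
      by (rule has_derivative_compose[OF _ der, of "\<lambda>y. (x,y)"]) (auto intro!: derivative_eq_intros)
    then show ?thesis
      by (simp add: has_vector_derivative_def mult.commute has_derivative_at_withinI)
  qed
  have z2: "integral (cbox 0 1) (\<lambda>y. p2 (x, y)) = 0" for x
    using fundamental_theorem_of_calculus[of 0 1 "\<lambda>y. \<phi> (x, y)" "\<lambda>y. p2 (x, y)"] d2 per(2)[of x 0]
    by (simp add: integral_unique)
  have z1: "integral (cbox 0 1) (\<lambda>x. p1 (x, y)) = 0" for y
    using fundamental_theorem_of_calculus[of 0 1 "\<lambda>x. \<phi> (x, y)" "\<lambda>x. p1 (x, y)"] d1 per(1)[of 0 y]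
    by (simp add: integral_unique)
  show "intT p2 = 0"
    using integral_prod_continuous[of 0 0 1 1 p2] z2 c by (simp add: eq)
  \<comment> \<open>The iterated integral puts the second variable inside, so for \<open>p1\<close>
    the order has to be exchanged first.\<close>
  have "integral (cbox (0,0) (1,1)) p1
      = integral (cbox 0 1) (\<lambda>x. integral (cbox 0 1) (\<lambda>y. p1 (x, y)))"
    using integral_prod_continuous[of 0 0 1 1 p1] c by simp
  also have "\<dots> = integral (cbox 0 1) (\<lambda>y. integral (cbox 0 1) (\<lambda>x. p1 (x, y)))"
    using integral_swap_continuous[of 0 0 1 1 "\<lambda>x y. p1 (x, y)"] c by (simp add: case_prod_beta)
  also have "\<dots> = 0" unfolding z1 by simp
  finally show "intT p1 = 0" using c by (simp add: eq)
qed

text \<open>The product of two test functions is again one, so the integral of its derivative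
  vanishes; the product rule splits this integral in two.\<close>

lemma C1per_weak_pd:
  assumes t: "C1per_test \<phi> p1 p2"
  shows "weak_pd i \<phi> (if i = 1 then p1 else p2)"
  unfolding weak_pd_def
proof (intro allI impI)
  fix \<psi> q1 q2 assume u: "C1per_test \<psi> q1 q2"
  note c = C1per_continuous[OF t, of Tbox] C1per_continuous[OF u, of Tbox]
  have i: "integrable torus (\<lambda>x. \<phi> x * q1 x)" "integrable torus (\<lambda>x. p1 x * \<psi> x)"
     "integrable torus (\<lambda>x. \<phi> x * q2 x)" "integrable torus (\<lambda>x. p2 x * \<psi> x)"
    by (intro continuous_torus continuous_intros c)+
  show "intT (\<lambda>x. \<phi> x * (if i = 1 then q1 x else q2 x)) = - intT (\<lambda>x. (if i = 1 then p1 else p2) x * \<psi> x)"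
    using C1per_integral_derivative[OF C1per_mult[OF t u]] i by (auto simp: intT_eq)
qed

text \<open>The phase lets one cosine stand for sine and cosine modes alike, and the amplitude
  absorbs scalar factors, so sums already give all real trigonometric polynomials.\<close>

inductive_set trig_poly :: "(real \<times> real \<Rightarrow> real) set" where
  mode: "(\<lambda>p. c * cos (2 * pi * (of_int k * fst p + of_int l * snd p) + \<theta>)) \<in> trig_poly"
| add: "f \<in> trig_poly \<Longrightarrow> g \<in> trig_poly \<Longrightarrow> (\<lambda>p. f p + g p) \<in> trig_poly"

lemma trig_mode_C1per:
  fixes k l :: int and \<theta> :: real
  defines "A \<equiv> \<lambda>p::real \<times> real. 2 * pi * (of_int k * fst p + of_int l * snd p) + \<theta>"
  shows "C1per_test (\<lambda>p. \<alpha> * cos (A p) + \<beta> * sin (A p))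
     (\<lambda>p. 2 * pi * of_int k * (\<beta> * cos (A p) - \<alpha> * sin (A p)))
     (\<lambda>p. 2 * pi * of_int l * (\<beta> * cos (A p) - \<alpha> * sin (A p)))"
proof -
  have "A (x + 1, y) = A (x, y) + 2 * pi * of_int k" "A (x, y + 1) = A (x, y) + 2 * pi * of_int l" for x y
    by (auto simp: A_def algebra_simps)
  then have per: "cos (A (x + 1, y)) = cos (A (x, y))" "cos (A (x, y + 1)) = cos (A (x, y))"
    "sin (A (x + 1, y)) = sin (A (x, y))" "sin (A (x, y + 1)) = sin (A (x, y))" for x y
    by (simp_all add: cos_add sin_add)
  have dA: "(A has_derivative (\<lambda>h. 2 * pi * (of_int k * fst h + of_int l * snd h))) (at p)" for p
    unfolding A_def by (auto intro!: derivative_eq_intros)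
  have cA: "continuous_on UNIV A" unfolding A_def by (intro continuous_intros)
  have "((\<lambda>p. \<alpha> * cos (A p) + \<beta> * sin (A p)) has_derivative
     (\<lambda>h. 2 * pi * of_int k * (\<beta> * cos (A p) - \<alpha> * sin (A p)) * fst h
        + 2 * pi * of_int l * (\<beta> * cos (A p) - \<alpha> * sin (A p)) * snd h)) (at p)" for p
    by (rule has_derivative_eq_rhs, (rule derivative_intros dA)+) (simp add: fun_eq_iff algebra_simps)
  then show ?thesis
    unfolding C1per_test_def periodic2_def per
    by (intro conjI allI continuous_intros cA) simp_all
qed

lemma C1per_add:
  assumes "C1per_test f f1 f2" "C1per_test g g1 g2"
  shows "C1per_test (\<lambda>x. f x + g x) (\<lambda>x. f1 x + g1 x) (\<lambda>x. f2 x + g2 x)"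
proof -
  have "((\<lambda>x. f x + g x) has_derivative (\<lambda>h. (f1 x + g1 x) * fst h + (f2 x + g2 x) * snd h)) (at x)" for x
    using has_derivative_add[OF C1per_has_derivative[OF assms(1)] C1per_has_derivative[OF assms(2)], of x]
    by (rule has_derivative_eq_rhs) (simp add: fun_eq_iff algebra_simps)
  then show ?thesis
    using assms unfolding C1per_test_def periodic2_def
    by (intro conjI allI) (auto intro!: continuous_intros)
qed

text \<open>The derivative maps the span of the cosine and sine of one frequency to itself. There
  \<open>1 + s * d\<close> is a 2 by 2 matrix of determinant \<open>1 + s^2 * w^2\<close>, hence
  invertible for every real \<open>s\<close>; sums follow by linearity.\<close>

lemma trig_poly_resolvent:
  assumes "q \<in> trig_poly"
  shows "\<exists>u p1 p2. C1per_test u p1 p2 \<and> (\<forall>x. u x + s * (if i = (1::nat) then p1 x else p2 x) = q x)"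
  using assms
proof induction
  case (mode c k l \<theta>)
  define w where "w = 2 * pi * (if i = 1 then of_int k else of_int l :: real)"
  \<comment> \<open>The solution of the 2 by 2 system for the right-hand side \<open>c * cos\<close>
    has cosine coefficient \<alpha> and sine coefficient \<open>s * w * \<alpha>\<close>.\<close>
  define \<alpha> where "\<alpha> = c / (1 + s\<^sup>2 * w\<^sup>2)"
  have nz: "1 + s\<^sup>2 * w\<^sup>2 \<noteq> 0"
    by (metis add_pos_nonneg less_irrefl mult_nonneg_nonneg zero_le_power2 zero_less_one)
  then have \<alpha>: "\<alpha> * (1 + s\<^sup>2 * w\<^sup>2) = c" by (simp add: \<alpha>_def)
  have "\<alpha> * C + s * w * \<alpha> * S + s * (w * (s * w * \<alpha> * C - \<alpha> * S)) = c * C" for C S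
    unfolding \<alpha>[symmetric] by (simp add: power2_eq_square algebra_simps)
  then have "\<forall>x. \<alpha> * cos (A x) + s * w * \<alpha> * sin (A x) + s * (if i = 1
     then 2 * pi * of_int k * (s * w * \<alpha> * cos (A x) - \<alpha> * sin (A x))
     else 2 * pi * of_int l * (s * w * \<alpha> * cos (A x) - \<alpha> * sin (A x))) = c * cos (A x)"
    for A :: "real \<times> real \<Rightarrow> real"
    unfolding w_def by (cases "i = 1") simp_all
  with trig_mode_C1per[of \<alpha> k l \<theta> "s * w * \<alpha>"] show ?case by blast
next
  case (add f g)
  then obtain u p1 p2 v q1 q2 where "C1per_test u p1 p2" "C1per_test v q1 q2"
    "\<And>x. u x + s * (if i = (1::nat) then p1 x else p2 x) = f x"
    "\<And>x. v x + s * (if i = (1::nat) then q1 x else q2 x) = g x" by blast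
  note uv = this
  have "\<forall>x. (u x + v x) + s * (if i = 1 then p1 x + q1 x else p2 x + q2 x) = f x + g x"
    unfolding uv(3)[symmetric] uv(4)[symmetric] by (simp add: algebra_simps)
  with C1per_add[OF uv(1,2)] show ?case by blast
qed

lemma trig_poly_const: "(\<lambda>_. c) \<in> trig_poly"
  using trig_poly.mode[of c 0 0 0] by simp

text \<open>Product-to-sum formula for two modes, extended bilinearly; this supplies the algebra for
  Stone-Weierstrass.\<close>

lemma trig_poly_mult:
  assumes "f \<in> trig_poly" "g \<in> trig_poly"
  shows "(\<lambda>p. f p * g p) \<in> trig_poly"
  using assms
proof (induction f)
  case (mode c k l \<theta>)
  from mode show ?case
  proof (induction g)
    case (mode d m n \<eta>)
    have "(\<lambda>p. c * cos (2 * pi * (of_int k * fst p + of_int l * snd p) + \<theta>) *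
              (d * cos (2 * pi * (of_int m * fst p + of_int n * snd p) + \<eta>)))
      = (\<lambda>p. c * d / 2 * cos (2 * pi * (of_int (k - m) * fst p + of_int (l - n) * snd p) + (\<theta> - \<eta>))
           + c * d / 2 * cos (2 * pi * (of_int (k + m) * fst p + of_int (l + n) * snd p) + (\<theta> + \<eta>)))"
    proof
      fix p :: "real \<times> real"
      let ?A = "2 * pi * (of_int k * fst p + of_int l * snd p) + \<theta>"
      let ?B = "2 * pi * (of_int m * fst p + of_int n * snd p) + \<eta>"
      have "2 * pi * (of_int (k - m) * fst p + of_int (l - n) * snd p) + (\<theta> - \<eta>) = ?A - ?B"
        "2 * pi * (of_int (k + m) * fst p + of_int (l + n) * snd p) + (\<theta> + \<eta>) = ?A + ?B"
        by (auto simp: algebra_simps)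
      then show "c * cos ?A * (d * cos ?B) = c * d / 2 * cos (2 * pi * (of_int (k - m) * fst p + of_int (l - n) * snd p) + (\<theta> - \<eta>))
           + c * d / 2 * cos (2 * pi * (of_int (k + m) * fst p + of_int (l + n) * snd p) + (\<theta> + \<eta>))"
        by (simp only: cos_add cos_diff) (simp add: algebra_simps)
    qed
    then show ?case by (simp only: trig_poly.intros)
  next
    case (add f g)
    then show ?case using trig_poly.add by (simp add: distrib_left)
  qed
next
  case (add f1 f2)
  then show ?case using trig_poly.add by (simp add: distrib_right)
qed

lemma trig_poly_continuous: "q \<in> trig_poly \<Longrightarrow> continuous_on S q"
  by (induction rule: trig_poly.induct) (auto intro!: continuous_intros)

subsection \<open>Density of trigonometric polynomials\<close>

lemma trig_poly_approx_continuous: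
  fixes h :: "real \<times> real \<Rightarrow> real"
  assumes h: "continuous_on Tbox h"
    and bd: "\<And>x y. (x, y) \<in> Tbox \<Longrightarrow> x \<in> {0,1} \<or> y \<in> {0,1} \<Longrightarrow> h (x, y) = 0"
    and \<epsilon>: "\<epsilon> > 0"
  shows "\<exists>q\<in>trig_poly. \<forall>p\<in>Tbox. \<bar>h p - q p\<bar> < \<epsilon>"
proof -
  txt \<open>The square maps onto a 2-torus in \<open>\<real>\<^sup>4\<close>, on whose points trigonometric polynomials separate;
    \<open>h\<close> factors through this map because it vanishes on the boundary.\<close>
  define e where "e = (\<lambda>p::real \<times> real. (cos (2 * pi * fst p), sin (2 * pi * fst p),
                       cos (2 * pi * snd p), sin (2 * pi * snd p)))"
  define H where "H = (\<lambda>z. h (inv_into Tbox e z))"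
  have e_cont: "continuous_on S e" for S
    unfolding e_def by (intro continuous_intros)
  have Tbox_iff: "(x, y) \<in> Tbox \<longleftrightarrow> 0 \<le> x \<and> x \<le> 1 \<and> 0 \<le> y \<and> y \<le> 1" for x y
    by (auto simp: Tbox_def cbox_Pair_eq)
  \<comment> \<open>Equal cosine and sine force an integer difference; inside the unit interval it
    is -1, 0 or 1, and only the endpoints can differ.\<close>
  have ends: "x = x' \<or> (x \<in> {0,1} \<and> x' \<in> {0,1})"
    if cs: "cos (2 * pi * x) = cos (2 * pi * x')" "sin (2 * pi * x) = sin (2 * pi * x')"
       and "0 \<le> x" "x \<le> 1" "0 \<le> x'" "x' \<le> 1" for x x' :: real
  proof -
    obtain n :: int where "2 * pi * x = 2 * pi * x' + 2 * pi * n"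
      using cs sin_cos_eq_iff[of "2 * pi * x" "2 * pi * x'"] by metis
    then have "2 * pi * x = 2 * pi * (x' + n)" by (simp add: distrib_left)
    then have "x = x' + n" by simp
    moreover from this \<open>0 \<le> x\<close> \<open>x \<le> 1\<close> \<open>0 \<le> x'\<close> \<open>x' \<le> 1\<close> have "-1 \<le> n" "n \<le> 1" by linarith+
    then have "n = -1 \<or> n = 0 \<or> n = 1" by linarith
    ultimately show ?thesis using that by auto
  qed
  \<comment> \<open>Two distinct points with the same image both lie on the boundary of the square,
    where \<open>h\<close> is 0.\<close>
  have wd: "h p = h p'" if eq: "e p = e p'" and p: "p \<in> Tbox" "p' \<in> Tbox" for p p'
  proof -
    obtain x y x' y' where xy: "p = (x, y)" "p' = (x', y')" by (cases p, cases p')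
    have "x = x' \<or> (x \<in> {0,1} \<and> x' \<in> {0,1})"
      by (rule ends) (use eq p in \<open>auto simp: xy e_def Tbox_iff\<close>)
    moreover have "y = y' \<or> (y \<in> {0,1} \<and> y' \<in> {0,1})"
      by (rule ends) (use eq p in \<open>auto simp: xy e_def Tbox_iff\<close>)
    ultimately show ?thesis using bd[of x y] bd[of x' y'] p unfolding xy by metis
  qed
  have He: "H (e p) = h p" if "p \<in> Tbox" for p
    unfolding H_def using that by (intro wd) (auto intro: f_inv_into_f inv_into_into)
  have cpt: "compact (e ` S)" if "closed S" "S \<subseteq> Tbox" for S
  proof -
    have "compact (S \<inter> Tbox)" using that by (simp add: Tbox_def closed_Int_compact)
    then show ?thesis using that by (simp add: Int_absorb2 compact_continuous_image e_cont)
  qed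
  have "closed Tbox" by (simp add: Tbox_def closed_cbox)
  note Tcl = this
  \<comment> \<open>\<open>e\<close> maps closed subsets of the compact square to compact sets, so
    preimages of closed sets under \<open>H\<close> are relatively closed.\<close>
  have Hc: "continuous_on (e ` Tbox) H"
    unfolding continuous_on_closed_invariant
  proof (intro allI impI)
    fix B :: "real set" assume "closed B"
    then have "closed (Tbox \<inter> h -` B)" by (rule continuous_closed_preimage[OF h Tcl])
    then have "compact (e ` (Tbox \<inter> h -` B))" by (rule cpt) auto
    then have "closed (e ` (Tbox \<inter> h -` B))" by (rule compact_imp_closed)
    moreover have "e ` (Tbox \<inter> h -` B) \<inter> e ` Tbox = H -` B \<inter> e ` Tbox"
      using He by (auto 4 4)
    ultimately show "\<exists>A. closed A \<and> A \<inter> e ` Tbox = H -` B \<inter> e ` Tbox" by blast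
  qed
  \<comment> \<open>Stone-Weierstrass is applied to the continuous functions on
    \<open>\<real>^4\<close> whose pullback under \<open>e\<close> is a trigonometric polynomial;
    the four coordinates belong to it, a phase of \<open>-pi/2\<close> giving the sines.\<close>
  define P where "P = (\<lambda>F. continuous_on UNIV F \<and> (\<lambda>p. F (e p)) \<in> trig_poly)"
  have coords: "P (\<lambda>z. fst z)" "P (\<lambda>z. fst (snd z))" "P (\<lambda>z. fst (snd (snd z)))" "P (\<lambda>z. snd (snd (snd z)))"
    using trig_poly.mode[of 1 1 0 0] trig_poly.mode[of 1 1 0 "-pi/2"]
      trig_poly.mode[of 1 0 1 0] trig_poly.mode[of 1 0 1 "-pi/2"]
    by (auto simp: P_def e_def cos_diff intro!: continuous_intros)
  have "\<exists>g. P g \<and> (\<forall>z\<in>e ` Tbox. \<bar>H z - g z\<bar> < \<epsilon>)"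
  proof (rule Stone_Weierstrass_HOL)
    show "compact (e ` Tbox)" using cpt[OF Tcl] by simp
    show "P (\<lambda>x. c)" for c by (auto simp: P_def trig_poly_const)
    show "continuous_on (e ` Tbox) f" if "P f" for f
      using that continuous_on_subset by (auto simp: P_def)
    show "P (\<lambda>x. f x + g x)" if "P f \<and> P g" for f g
      using that by (auto simp: P_def intro: continuous_intros trig_poly.add)
    show "P (\<lambda>x. f x * g x)" if "P f \<and> P g" for f g
      using that by (auto simp: P_def intro: continuous_intros trig_poly_mult)
    show "\<exists>f. P f \<and> f x \<noteq> f y" if "x \<in> e ` Tbox \<and> y \<in> e ` Tbox \<and> x \<noteq> y" for x y
      using that coords by (metis prod.expand)
  qed (use Hc \<epsilon> in auto)
  then show ?thesis using He by (auto simp: P_def)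
qed

lemma l2norm_dominated_convergence:
  assumes f: "f \<in> borel_measurable M" and s: "\<And>i. s i \<in> borel_measurable M"
    and w: "integrable M (\<lambda>x. (w x)\<^sup>2)"
    and lim: "AE x in M. (\<lambda>i. s i x) \<longlonglongrightarrow> f x"
    and bound: "\<And>i. AE x in M. \<bar>f x - s i x\<bar> \<le> w x"
  shows "(\<lambda>i. l2norm M (\<lambda>x. f x - s i x)) \<longlonglongrightarrow> 0"
proof -
  have "(\<lambda>i. \<integral>x. (f x - s i x)\<^sup>2 \<partial>M) \<longlonglongrightarrow> (\<integral>x. 0 \<partial>M)"
  proof (rule integral_dominated_convergence[where w="\<lambda>x. (w x)\<^sup>2"])
    show "AE x in M. (\<lambda>i. (f x - s i x)\<^sup>2) \<longlonglongrightarrow> 0"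
      using lim
    proof eventually_elim
      case (elim x)
      have "(\<lambda>i. (f x - s i x)\<^sup>2) \<longlonglongrightarrow> (f x - f x)\<^sup>2"
        by (intro tendsto_intros elim)
      then show ?case by simp
    qed
    show "AE x in M. norm ((f x - s i x)\<^sup>2) \<le> (w x)\<^sup>2" for i
      using bound[of i] by eventually_elim (metis abs_ge_zero norm_power power2_abs power_mono real_norm_def)
  qed (use f s w in auto)
  then show ?thesis
    unfolding l2norm_def using tendsto_real_sqrt by fastforce
qed

text \<open>Measurability yields continuous functions converging to \<open>f\<close> almost
  everywhere. They are clamped to the bound \<open>b\<close>, cut off near the boundary, and then
  approximated uniformly.\<close>

lemma trig_poly_dense_bounded:
  assumes f: "f \<in> borel_measurable torus" and b: "\<And>x. \<bar>f x\<bar> \<le> b" and \<epsilon>: "\<epsilon> > 0"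
  shows "\<exists>q\<in>trig_poly. l2norm torus (\<lambda>x. f x - q x) < \<epsilon>"
proof -
  have b0: "b \<ge> 0" using b[of undefined] abs_ge_zero order_trans by blast
  have "f measurable_on Tbox"
    using f by (simp add: measurable_on_iff_borel_measurable)
  then obtain N g where N: "negligible N" and g: "\<And>n. continuous_on UNIV (g n :: real \<times> real \<Rightarrow> real)"
    and lim: "\<And>x. x \<notin> N \<Longrightarrow> (\<lambda>n. g n x) \<longlonglongrightarrow> (if x \<in> Tbox then f x else 0)"
    unfolding measurable_on_def by blast
  \<comment> \<open>A continuous cutoff that vanishes on the boundary of the square and, at each
    interior point, equals 1 for all large \<open>n\<close>.\<close>
  define \<kappa> where "\<kappa> = (\<lambda>(n::nat) p::real \<times> real. min 1 (real n * (fst p * (1 - fst p) * (snd p * (1 - snd p)))))"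
  define h where "h = (\<lambda>n p. \<kappa> n p * max (-b) (min b (g n p)))"
  have h_cont: "continuous_on S (h n)" for n S
    unfolding h_def \<kappa>_def by (intro continuous_intros continuous_on_subset[OF g]) auto
  have \<kappa>01: "0 \<le> \<kappa> n p" "\<kappa> n p \<le> 1" if "p \<in> Tbox" for n p
    using that by (auto simp: \<kappa>_def Tbox_def cbox_Pair_eq)
  have h_bound: "\<bar>h n p\<bar> \<le> b" if "p \<in> Tbox" for n p
  proof -
    have "\<bar>max (-b) (min b (g n p))\<bar> \<le> b" using b0 by auto
    then have "\<kappa> n p * \<bar>max (-b) (min b (g n p))\<bar> \<le> 1 * b"
      using \<kappa>01[OF that] by (intro mult_mono) auto
    then show ?thesis using \<kappa>01[OF that] by (simp add: h_def abs_mult)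
  qed
  have "(\<lambda>n. l2norm torus (\<lambda>x. f x - h n x)) \<longlonglongrightarrow> 0"
  proof (rule l2norm_dominated_convergence[where w="\<lambda>_. 2 * b"])
    show "h n \<in> borel_measurable torus" for n
      using continuous_torus(2)[OF h_cont] by (simp add: square_integrable_def)
    show "integrable torus (\<lambda>x. (2 * b)\<^sup>2)"
      by (intro continuous_torus continuous_intros)
    have "\<bar>f x - h n x\<bar> \<le> 2 * b" if "x \<in> Tbox" for n x
      using b[of x] h_bound[OF that, of n] by linarith
    then show "AE x in torus. \<bar>f x - h n x\<bar> \<le> 2 * b" for n
      by (simp add: AE_restrict_space_iff)
    \<comment> \<open>On the boundary the cutoff stays 0 and convergence may fail, but the boundary
      has measure zero.\<close>
    have "negligible (Tbox - box (0,0) (1,1))"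
      unfolding Tbox_def by (rule negligible_frontier_interval)
    then have "negligible (N \<union> (Tbox - box (0,0) (1,1)))" (is "negligible ?N") using N by simp
    then have "AE x in lebesgue. x \<notin> ?N"
      unfolding negligible_iff_null_sets by (rule AE_not_in)
    then have "AE x in lebesgue. x \<in> Tbox \<longrightarrow> (\<lambda>n. h n x) \<longlonglongrightarrow> f x"
    proof eventually_elim
      case (elim x)
      show ?case
      proof
        assume x: "x \<in> Tbox"
        then have "x \<in> box (0,0) (1,1)" using elim by auto
        then have pos: "fst x * (1 - fst x) * (snd x * (1 - snd x)) > 0" (is "?c > 0")
          by (cases x) (auto simp: mem_box Basis_prod_def)
        obtain m :: nat where m: "real m * ?c \<ge> 1"
          using reals_Archimedean3[OF pos] by (meson less_imp_le)
        have "\<forall>\<^sub>F n in sequentially. 1 = \<kappa> n x"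
          unfolding eventually_sequentially \<kappa>_def
        proof (intro exI allI impI)
          fix n assume "m \<le> n"
          then have "real m * ?c \<le> real n * ?c" using pos by (intro mult_right_mono) auto
          then show "1 = min 1 (real n * ?c)" using m by simp
        qed
        then have "(\<lambda>n. \<kappa> n x) \<longlonglongrightarrow> 1" by (rule tendsto_eventually[OF eventually_mono]) auto
        moreover have "(\<lambda>n. max (-b) (min b (g n x))) \<longlonglongrightarrow> max (-b) (min b (f x))"
          using lim[of x] elim x by (intro tendsto_intros) auto
        ultimately have "(\<lambda>n. h n x) \<longlonglongrightarrow> 1 * max (-b) (min b (f x))"
          unfolding h_def by (rule tendsto_mult)
        moreover have "max (-b) (min b (f x)) = f x" using b[of x] by (auto simp: abs_le_iff)
        ultimately show "(\<lambda>n. h n x) \<longlonglongrightarrow> f x" by simp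
      qed
    qed
    then show "AE x in torus. (\<lambda>n. h n x) \<longlonglongrightarrow> f x" by (simp add: AE_restrict_space_iff)
  qed (use f in auto)
  then have "\<forall>\<^sub>F n in sequentially. l2norm torus (\<lambda>x. f x - h n x) < \<epsilon> / 2"
    by (rule order_tendstoD) (use \<epsilon> in auto)
  then obtain n where n: "l2norm torus (\<lambda>x. f x - h n x) < \<epsilon> / 2"
    by (auto simp: eventually_sequentially)
  have "h n (x, y) = 0" if "x \<in> {0,1} \<or> y \<in> {0,1}" for x y
    using that by (auto simp: h_def \<kappa>_def)
  then obtain q where q: "q \<in> trig_poly" "\<And>p. p \<in> Tbox \<Longrightarrow> \<bar>h n p - q p\<bar> < \<epsilon> / 2"
    using trig_poly_approx_continuous[OF h_cont, of n "\<epsilon> / 2"] \<epsilon> by (metis half_gt_zero)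
  have sf: "square_integrable torus f"
    by (rule l2norm_uniform_bound[OF finite_measure_torus f b b0])
  note sh = continuous_torus(2)[OF h_cont, of n]
  note sq = continuous_torus(2)[OF trig_poly_continuous[OF q(1)]]
  \<comment> \<open>The square has measure 1, so the uniform error bounds the L2 error with the same
    constant.\<close>
  have "l2norm torus (\<lambda>x. h n x - q x) \<le> \<epsilon> / 2 * sqrt (measure torus (space torus))"
    by (rule l2norm_uniform_bound[OF finite_measure_torus])
      (use square_integrable_diff[OF sh sq] q \<epsilon> in \<open>auto simp: square_integrable_def intro: less_imp_le\<close>)
  moreover have "l2norm torus (\<lambda>x. (f x - h n x) + (h n x - q x))
      \<le> l2norm torus (\<lambda>x. f x - h n x) + l2norm torus (\<lambda>x. h n x - q x)"
    by (intro l2norm_triangle square_integrable_diff sf sh sq)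
  ultimately have "l2norm torus (\<lambda>x. f x - q x) < \<epsilon>"
    using n by (simp add: measure_torus)
  then show ?thesis using q(1) by blast
qed

text \<open>Truncation at height \<open>n\<close> converges in L2, dominated by the absolute value
  of \<open>f\<close>, and reduces to bounded functions.\<close>

lemma trig_poly_dense:
  assumes f: "square_integrable torus f" and \<epsilon>: "\<epsilon> > 0"
  shows "\<exists>q\<in>trig_poly. l2norm torus (\<lambda>x. f x - q x) < \<epsilon>"
proof -
  define t where "t = (\<lambda>(n::nat) x. max (- real n) (min (real n) (f x)))"
  have fm [measurable]: "f \<in> borel_measurable torus" and fi: "integrable torus (\<lambda>x. (f x)\<^sup>2)"
    using f by (auto simp: square_integrable_def)
  have tm [measurable]: "t n \<in> borel_measurable torus" for n
    unfolding t_def by measurable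
  have "(\<lambda>n. l2norm torus (\<lambda>x. f x - t n x)) \<longlonglongrightarrow> 0"
  proof (rule l2norm_dominated_convergence[where w="\<lambda>x. \<bar>f x\<bar>"])
    show "AE x in torus. (\<lambda>n. t n x) \<longlonglongrightarrow> f x"
    proof (rule AE_I2)
      fix x
      obtain m :: nat where m: "\<bar>f x\<bar> \<le> m" using real_arch_simple by blast
      have "\<forall>\<^sub>F n in sequentially. t n x = f x"
        unfolding eventually_sequentially t_def
      proof (intro exI allI impI)
        fix n assume "m \<le> n"
        then have "\<bar>f x\<bar> \<le> real n" using m by linarith
        then show "max (- real n) (min (real n) (f x)) = f x" by (auto simp: abs_le_iff)
      qed
      then show "(\<lambda>n. t n x) \<longlonglongrightarrow> f x" by (rule tendsto_eventually)
    qed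
    show "AE x in torus. \<bar>f x - t n x\<bar> \<le> \<bar>f x\<bar>" for n
      by (rule AE_I2) (auto simp: t_def max_def min_def)
  qed (use fi in auto)
  then have "\<forall>\<^sub>F n in sequentially. l2norm torus (\<lambda>x. f x - t n x) < \<epsilon> / 2"
    by (rule order_tendstoD) (use \<epsilon> in auto)
  then obtain n where n: "l2norm torus (\<lambda>x. f x - t n x) < \<epsilon> / 2"
    by (auto simp: eventually_sequentially)
  have tb: "\<bar>t n x\<bar> \<le> real n" for x by (auto simp: t_def)
  obtain q where q: "q \<in> trig_poly" "l2norm torus (\<lambda>x. t n x - q x) < \<epsilon> / 2"
    using trig_poly_dense_bounded[OF tm tb] \<epsilon> by (metis half_gt_zero)
  have st: "square_integrable torus (t n)"
    by (rule l2norm_uniform_bound[OF finite_measure_torus tm tb]) simp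
  note sq = continuous_torus(2)[OF trig_poly_continuous[OF q(1)]]
  have "l2norm torus (\<lambda>x. (f x - t n x) + (t n x - q x))
      \<le> l2norm torus (\<lambda>x. f x - t n x) + l2norm torus (\<lambda>x. t n x - q x)"
    by (intro l2norm_triangle square_integrable_diff f st sq)
  then show ?thesis using n q by (intro bexI[of _ q]) auto
qed

subsection \<open>Integration by parts for weak derivatives\<close>

definition ipT :: "(real \<times> real \<Rightarrow> real) \<Rightarrow> (real \<times> real \<Rightarrow> real) \<Rightarrow> real" where
  "ipT f g = (\<integral>x. f x * g x \<partial>torus)"

lemma ipT_commute: "ipT f g = ipT g f"
  by (simp add: ipT_def mult.commute)

lemma ipT_cmult_right: "ipT f (\<lambda>x. c * g x) = c * ipT f g"
  by (simp add: ipT_def mult.left_commute)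

lemma ipT_add_right:
  assumes "square_integrable torus f" "square_integrable torus g" "square_integrable torus h"
  shows "ipT f (\<lambda>x. g x + h x) = ipT f g + ipT f h"
  using assms by (simp add: ipT_def distrib_left square_integrable_mult)

lemma ipT_diff_right:
  assumes "square_integrable torus f" "square_integrable torus g" "square_integrable torus h"
  shows "ipT f (\<lambda>x. g x - h x) = ipT f g - ipT f h"
  using assms by (simp add: ipT_def right_diff_distrib square_integrable_mult)

lemma ipT_cmult_left: "ipT (\<lambda>x. c * g x) f = c * ipT g f"
  using ipT_cmult_right ipT_commute by metis

lemma ipT_add_left:
  assumes "square_integrable torus f" "square_integrable torus g" "square_integrable torus h"
  shows "ipT (\<lambda>x. g x + h x) f = ipT g f + ipT h f"
  using ipT_add_right[OF assms] ipT_commute by metis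

lemma ipT_cong_AE:
  assumes "square_integrable torus f" "square_integrable torus g" "square_integrable torus h"
    and "AE x in torus. g x = h x"
  shows "ipT f g = ipT f h"
  unfolding ipT_def
  by (rule integral_cong_AE) (use assms in \<open>auto simp: square_integrable_def\<close>)

lemma ipT_self_nonneg: "ipT f f \<ge> 0"
  by (simp add: ipT_def)

lemma ipT_diff_left:
  assumes "square_integrable torus f" "square_integrable torus g" "square_integrable torus h"
  shows "ipT (\<lambda>x. g x - h x) f = ipT g f - ipT h f"
  using ipT_diff_right[OF assms] ipT_commute by metis

lemma abs_ipT_le:
  "square_integrable torus f \<Longrightarrow> square_integrable torus g \<Longrightarrow>
    \<bar>ipT f g\<bar> \<le> l2norm torus f * l2norm torus g"
  unfolding ipT_def by (rule Cauchy_Schwarz_integral)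

lemma weak_pd_test:
  assumes "weak_pd i f g" "C1per_test \<phi> p1 p2"
  shows "ipT f (\<lambda>x. if i = 1 then p1 x else p2 x) = - ipT g \<phi>"
  using assms unfolding weak_pd_def ipT_def intT_eq by blast

lemmas ipT_bilinear = ipT_add_right ipT_cmult_right ipT_add_left ipT_cmult_left

text \<open>Young's inequality by completing the square: \<open>4 * \<gamma>\<close> times the form
  is at least the squared norm of \<open>\<beta> * f + 2 * \<gamma> * g\<close>.\<close>

lemma ipT_quadratic_form_nonneg:
  assumes f: "square_integrable torus f" and g: "square_integrable torus g"
    and "\<alpha> \<ge> 0" "\<gamma> > 0" "\<beta>\<^sup>2 \<le> 4 * \<alpha> * \<gamma>"
  shows "\<alpha> * ipT f f + \<beta> * ipT f g + \<gamma> * ipT g g \<ge> 0"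
proof -
  have "0 \<le> ipT (\<lambda>x. \<beta> * f x + 2 * \<gamma> * g x) (\<lambda>x. \<beta> * f x + 2 * \<gamma> * g x)"
    by (rule ipT_self_nonneg)
  also have "\<dots> = \<beta>\<^sup>2 * ipT f f + 4 * \<gamma> * (\<beta> * ipT f g + \<gamma> * ipT g g)"
    using f g ipT_commute[of g f]
    by (simp only: ipT_bilinear square_integrable_add square_integrable_cmult)
      (simp add: power2_eq_square algebra_simps)
  also have "\<dots> \<le> 4 * \<alpha> * \<gamma> * ipT f f + 4 * \<gamma> * (\<beta> * ipT f g + \<gamma> * ipT g g)"
    using assms ipT_self_nonneg[of f] by (intro add_right_mono mult_right_mono) auto
  finally have "0 \<le> 4 * \<gamma> * (\<alpha> * ipT f f + \<beta> * ipT f g + \<gamma> * ipT g g)"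
    by (simp add: algebra_simps)
  then show ?thesis using assms by (simp add: zero_le_mult_iff)
qed


text \<open>A periodic function is orthogonal to its derivative, so by Pythagoras the right-hand
  side squared is the sum of both squared norms. This bounds resolvent solutions by their
  data.\<close>

lemma C1per_l2norm_le:
  assumes t: "C1per_test u p1 p2" and s: "s\<^sup>2 = 1"
  shows "l2norm torus u \<le> l2norm torus (\<lambda>x. u x + s * (if i = (1::nat) then p1 x else p2 x))"
proof -
  define p where "p = (if i = 1 then p1 else p2)"
  have pi: "(if i = 1 then p1 x else p2 x) = p x" for x by (simp add: p_def)
  note c = C1per_continuous[OF t, of Tbox]
  have su: "square_integrable torus u" and sp: "square_integrable torus p"
    using c by (auto simp: p_def intro: continuous_torus)
  have "ipT u p = - ipT p u"
    using weak_pd_test[OF C1per_weak_pd[OF t, of i] t] unfolding pi p_def[symmetric] .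
  then have skew: "(\<integral>x. u x * p x \<partial>torus) = 0"
    using ipT_commute[of u p] by (simp add: ipT_def)
  have "(l2norm torus (\<lambda>x. u x + s * p x))\<^sup>2
      = (\<integral>x. (u x)\<^sup>2 + (p x)\<^sup>2 + 2 * s * (u x * p x) \<partial>torus)"
    unfolding l2norm_power2 
    by (intro Bochner_Integration.integral_cong) (auto simp: power2_sum power_mult_distrib s)
  also have "\<dots> = (l2norm torus u)\<^sup>2 + (l2norm torus p)\<^sup>2"
    using su sp square_integrable_mult[OF su sp] skew by (simp add: l2norm_power2 square_integrable_def)
  finally have "(l2norm torus u)\<^sup>2 \<le> (l2norm torus (\<lambda>x. u x + s * p x))\<^sup>2" by simp
  then show ?thesis unfolding pi by (rule power2_le_imp_le) simp
qed

text \<open>Density of the range of \<open>1 + s * d\<close>, with control of the preimage: the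
  equation is solved exactly for a trigonometric polynomial close to \<open>f\<close>.\<close>

lemma resolvent_approx:
  assumes f: "square_integrable torus f" and s: "s\<^sup>2 = 1" and \<epsilon>: "\<epsilon> > 0"
  obtains u p1 p2 where "C1per_test u p1 p2"
    "l2norm torus (\<lambda>x. f x - (u x + s * (if i = (1::nat) then p1 x else p2 x))) < \<epsilon>"
    "l2norm torus u \<le> l2norm torus f + \<epsilon>"
proof -
  obtain q where q: "q \<in> trig_poly" "l2norm torus (\<lambda>x. f x - q x) < \<epsilon>"
    using trig_poly_dense[OF f \<epsilon>] by blast
  obtain u p1 p2 where u: "C1per_test u p1 p2"
      "\<And>x. u x + s * (if i = 1 then p1 x else p2 x) = q x"
    using trig_poly_resolvent[OF q(1)] by blast
  note sq = continuous_torus(2)[OF trig_poly_continuous[OF q(1)]]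
  have "l2norm torus u \<le> l2norm torus q"
    using C1per_l2norm_le[OF u(1) s, of i] unfolding u(2) .
  also have "\<dots> \<le> l2norm torus f + l2norm torus (\<lambda>x. f x - q x)"
    using l2norm_triangle_diff[OF f square_integrable_diff[OF f sq]] by simp
  finally show ?thesis using that[OF u(1)] q(2) unfolding u(2) by simp
qed

theorem weak_integration_by_parts:
  assumes f: "square_integrable torus f" "square_integrable torus f'" "weak_pd i f f'"
    and g: "square_integrable torus g" "square_integrable torus g'" "weak_pd i g g'"
  shows "ipT f g' = - ipT f' g"
proof -
  define X where "X = ipT f g' + ipT f' g"
  define F where "F = (\<lambda>x. f x + f' x)"
  define G where "G = (\<lambda>x. g x - g' x)"
  have sF: "square_integrable torus F" and sG: "square_integrable torus G"
    unfolding F_def G_def by (intro square_integrable_add square_integrable_diff f g)+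
  \<comment> \<open>The summands bound the norms of \<open>g\<close>, \<open>d = f - u\<close> and
    \<open>v\<close>; each 1 absorbs the \<epsilon> lost in \<open>resolvent_approx\<close>.\<close>
  define K where "K = l2norm torus g + (l2norm torus f + l2norm torus F + 1) + (l2norm torus G + 1)"
  txt \<open>Approximate \<open>f + f'\<close> by \<open>u + u'\<close> and \<open>g - g'\<close> by \<open>v - v'\<close>. The test function \<open>u\<close> contributes nothing
    to \<open>X\<close>, and the remainder \<open>d = f - u\<close> satisfies \<open>\<langle>d, v - v'\<rangle> = \<langle>d + d', v\<rangle>\<close>, which is small.\<close>
  have key: "\<bar>X\<bar> \<le> \<epsilon> * K" if \<epsilon>: "0 < \<epsilon>" "\<epsilon> \<le> 1" for \<epsilon>
  proof -
    obtain u p1 p2 where u: "C1per_test u p1 p2"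
      "l2norm torus (\<lambda>x. F x - (u x + 1 * (if i = 1 then p1 x else p2 x))) < \<epsilon>"
      "l2norm torus u \<le> l2norm torus F + \<epsilon>"
      by (rule resolvent_approx[OF sF _ \<epsilon>(1), of 1]) auto
    obtain v q1 q2 where v: "C1per_test v q1 q2"
      "l2norm torus (\<lambda>x. G x - (v x + (-1) * (if i = 1 then q1 x else q2 x))) < \<epsilon>"
      "l2norm torus v \<le> l2norm torus G + \<epsilon>"
      by (rule resolvent_approx[OF sG _ \<epsilon>(1), of "-1"]) auto
    define u' where "u' = (\<lambda>x. if i = 1 then p1 x else p2 x)"
    define v' where "v' = (\<lambda>x. if i = 1 then q1 x else q2 x)"
    have u'_eq: "u' = (if i = 1 then p1 else p2)" and v'_eq: "v' = (if i = 1 then q1 else q2)"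
      by (simp_all add: u'_def v'_def)
    have s: "square_integrable torus u" "square_integrable torus u'"
       "square_integrable torus v" "square_integrable torus v'"
      using C1per_continuous[OF u(1), of Tbox] C1per_continuous[OF v(1), of Tbox]
      unfolding u'_eq v'_eq by (simp_all add: continuous_torus)
    have w_u: "weak_pd i u u'"
      using C1per_weak_pd[OF u(1), of i] unfolding u'_eq .
    have fv: "ipT f v' = - ipT f' v" and uv: "ipT u v' = - ipT u' v" and gu: "ipT g u' = - ipT g' u"
      unfolding u'_def v'_def
      using weak_pd_test[OF f(3) v(1)] weak_pd_test[OF w_u v(1)] weak_pd_test[OF g(3) u(1)]
      unfolding u'_def by blast+
    define d where "d = (\<lambda>x. f x - u x)"
    define d' where "d' = (\<lambda>x. f' x - u' x)"
    have sd: "square_integrable torus d" "square_integrable torus d'"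
      unfolding d_def d'_def by (intro square_integrable_diff f s)+
    define R where "R = (\<lambda>x. d x + d' x)"
    define S where "S = (\<lambda>x. G x - (v x - v' x))"
    have sR: "square_integrable torus R" and sS: "square_integrable torus S"
      unfolding R_def S_def by (intro square_integrable_add square_integrable_diff sd s sG)+
    have R: "l2norm torus R < \<epsilon>"
      using u(2) by (simp add: R_def d_def d'_def F_def u'_def algebra_simps)
    have S: "l2norm torus S < \<epsilon>"
      using v(2) by (simp add: S_def v'_def)
    note lin = ipT_add_left ipT_diff_left ipT_diff_right f g s
      square_integrable_add square_integrable_diff
    \<comment> \<open>Since \<open>u\<close> drops out, \<open>X\<close> is the pairing of
      \<open>R\<close> with \<open>g\<close> minus that of \<open>d\<close> with \<open>G\<close>.
      Splitting \<open>G = S + (v - v')\<close> and moving the derivative off the test function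
      \<open>v\<close> turns the pairing of \<open>d\<close> with \<open>v - v'\<close> into that of
      \<open>R\<close> with \<open>v\<close>.\<close>
    have "X = ipT R g - ipT R v - ipT d S"
      unfolding X_def R_def d_def d'_def S_def G_def
      using fv uv gu ipT_commute[of g u'] ipT_commute[of g' u] by (simp add: lin)
    also have "\<bar>\<dots>\<bar> \<le> \<bar>ipT R g\<bar> + \<bar>ipT R v\<bar> + \<bar>ipT d S\<bar>" by linarith
    also have "\<dots> \<le> l2norm torus R * l2norm torus g + l2norm torus R * l2norm torus v
        + l2norm torus d * l2norm torus S"
      by (intro add_mono abs_ipT_le sR g s sd sS)
    also have "\<dots> \<le> \<epsilon> * l2norm torus g + \<epsilon> * (l2norm torus G + 1)
        + (l2norm torus f + l2norm torus F + 1) * \<epsilon>"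
      using R S u(3) v(3) \<epsilon> l2norm_triangle_diff[OF f(1) s(1)]
      by (intro add_mono mult_mono) (auto simp: d_def intro: add_nonneg_nonneg)
    also have "\<dots> = \<epsilon> * K" by (simp add: K_def algebra_simps)
    finally show ?thesis .
  qed
  have K: "K > 0" unfolding K_def by (simp add: add_nonneg_pos add_pos_nonneg)
  have "X = 0"
  proof (rule ccontr)
    assume "X \<noteq> 0"
    define \<epsilon> where "\<epsilon> = min 1 (\<bar>X\<bar> / (2 * K))"
    have "0 < \<epsilon>" "\<epsilon> \<le> 1" using K \<open>X \<noteq> 0\<close> by (auto simp: \<epsilon>_def)
    from key[OF this] have "\<bar>X\<bar> \<le> \<epsilon> * K" .
    also have "\<dots> \<le> \<bar>X\<bar> / (2 * K) * K" using K by (intro mult_right_mono) (auto simp: \<epsilon>_def)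
    also have "\<dots> = \<bar>X\<bar> / 2" using K by simp
    finally show False using \<open>X \<noteq> 0\<close> by simp
  qed
  then show ?thesis by (simp add: X_def)
qed

subsection \<open>Energy dissipation\<close>

text \<open>Expand the square of \<open>F s = F t + (s - t) * G t + R s\<close>, with
  \<open>R s\<close> of smaller order than \<open>s - t\<close> in L2. At \<open>t = 0\<close> the
  derivative is one-sided.\<close>

lemma C1_L2_norm_derivative:
  assumes FG: "C1_L2 F G" and t: "t \<ge> 0"
  shows "((\<lambda>s. intT (\<lambda>x. (F s x)\<^sup>2)) has_real_derivative 2 * (\<integral>x. F t x * G t x \<partial>torus))
           (at t within {0..})"
proof -
  have sF: "square_integrable torus (F s)" and sG: "square_integrable torus (G s)" if "s \<ge> 0" for s
    using FG that by (auto simp: C1_L2_def intro: L2T_square_integrable)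
  define R where "R = (\<lambda>s x. F s x - F t x - (s - t) * G t x)"
  define \<rho> where "\<rho> = (\<lambda>s. l2norm torus (R s) / \<bar>s - t\<bar>)"
  have \<rho>: "(\<rho> \<longlongrightarrow> 0) (at t within {0..})"
    using FG t unfolding C1_L2_def L2normT_eq \<rho>_def R_def by blast
  define a b where "a = l2norm torus (F t)" and "b = l2norm torus (G t)"
  define D where "D = (\<integral>x. F t x * G t x \<partial>torus)"
  \<comment> \<open>The first error term comes from pairing \<open>F t\<close> with the remainder,
    the second from the squared increment \<open>F s - F t\<close>.\<close>
  have est: "\<bar>(intT (\<lambda>x. (F s x)\<^sup>2) - intT (\<lambda>x. (F t x)\<^sup>2)) / (s - t) - 2 * D\<bar>
      \<le> 2 * a * \<rho> s + (\<rho> s + b)\<^sup>2 * \<bar>s - t\<bar>" if s: "s \<ge> 0" "s \<noteq> t" for s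
  proof -
    note sq = sF[OF t] sG[OF t] sF[OF s(1)]
    have sR: "square_integrable torus (R s)"
      unfolding R_def by (intro square_integrable_diff square_integrable_cmult sq)
    have sd: "square_integrable torus (\<lambda>x. F s x - F t x)"
      by (intro square_integrable_diff sq)
    have "intT (\<lambda>x. (F s x)\<^sup>2) = (\<integral>x. (F t x)\<^sup>2 + 2 * (s - t) * (F t x * G t x)
         + 2 * (F t x * R s x) + (F s x - F t x)\<^sup>2 \<partial>torus)"
      unfolding intT_eq R_def by (intro Bochner_Integration.integral_cong) (auto simp: power2_eq_square algebra_simps)
    also have "\<dots> = intT (\<lambda>x. (F t x)\<^sup>2) + 2 * (s - t) * D + 2 * (\<integral>x. F t x * R s x \<partial>torus)
         + (l2norm torus (\<lambda>x. F s x - F t x))\<^sup>2"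
      using sq sd sR square_integrable_mult[OF sq(1,2)] square_integrable_mult[OF sq(1) sR]
      by (simp add: intT_eq D_def l2norm_power2 square_integrable_def)
    finally have "(intT (\<lambda>x. (F s x)\<^sup>2) - intT (\<lambda>x. (F t x)\<^sup>2)) / (s - t) - 2 * D
       = (2 * (\<integral>x. F t x * R s x \<partial>torus) + (l2norm torus (\<lambda>x. F s x - F t x))\<^sup>2) / (s - t)"
      using s by (simp add: field_simps)
    also have "\<bar>\<dots>\<bar> \<le> (2 * \<bar>\<integral>x. F t x * R s x \<partial>torus\<bar> + (l2norm torus (\<lambda>x. F s x - F t x))\<^sup>2) / \<bar>s - t\<bar>"
      unfolding abs_divide
      by (intro divide_right_mono) (auto intro: order_trans[OF abs_triangle_ineq])
    also have "\<dots> \<le> (2 * (a * l2norm torus (R s)) + (l2norm torus (R s) + \<bar>s - t\<bar> * b)\<^sup>2) / \<bar>s - t\<bar>"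
    proof (intro divide_right_mono add_mono mult_left_mono power_mono)
      show "\<bar>\<integral>x. F t x * R s x \<partial>torus\<bar> \<le> a * l2norm torus (R s)"
        unfolding a_def by (rule Cauchy_Schwarz_integral[OF sq(1) sR])
      show "l2norm torus (\<lambda>x. F s x - F t x) \<le> l2norm torus (R s) + \<bar>s - t\<bar> * b"
        using l2norm_triangle[OF sR square_integrable_cmult[OF sq(2), of "s - t"]]
        by (simp add: R_def b_def l2norm_cmult)
    qed auto
    also have "\<dots> = 2 * a * \<rho> s + (\<rho> s + b)\<^sup>2 * \<bar>s - t\<bar>"
    proof -
      have "l2norm torus (R s) = \<rho> s * \<bar>s - t\<bar>" using s by (simp add: \<rho>_def)
      then show ?thesis using s by (simp add: field_simps power2_eq_square)
    qed
    finally show ?thesis .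
  qed
  have "((\<lambda>s. 2 * a * \<rho> s + (\<rho> s + b)\<^sup>2 * \<bar>s - t\<bar>) \<longlongrightarrow> 2 * a * 0 + (0 + b)\<^sup>2 * \<bar>t - t\<bar>) (at t within {0..})"
    by (intro tendsto_intros \<rho>)
  then have lim0: "((\<lambda>s. 2 * a * \<rho> s + (\<rho> s + b)\<^sup>2 * \<bar>s - t\<bar>) \<longlongrightarrow> 0) (at t within {0..})" by simp
  have "((\<lambda>s. (intT (\<lambda>x. (F s x)\<^sup>2) - intT (\<lambda>x. (F t x)\<^sup>2)) / (s - t) - 2 * D) \<longlongrightarrow> 0) (at t within {0..})"
    by (rule Lim_null_comparison[OF _ lim0]) (use est in \<open>auto simp: eventually_at_filter\<close>)
  then show ?thesis
    unfolding has_field_derivative_iff D_def[symmetric] by (simp add: LIM_zero_iff)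
qed

section \<open>The spatial operators on H2 functions, integrated by parts\<close>

lemma H2T_pd:
  assumes "H2T f" "i \<in> {1,2}"
  shows "square_integrable torus (pd i f)" "weak_pd i f (pd i f)"
proof -
  \<comment> \<open>\<open>pd\<close> is a choice; it is a weak derivative only once one is known to
    exist, which \<open>H2T\<close> guarantees.\<close>
  have "\<exists>g. L2T g \<and> weak_pd i f g" using assms unfolding H2T_def by blast
  then have "L2T (pd i f) \<and> weak_pd i f (pd i f)" unfolding pd_def by (rule someI_ex)
  then show "square_integrable torus (pd i f)" "weak_pd i f (pd i f)"
    by (auto intro: L2T_square_integrable)
qed

lemma H2T_d2:
  assumes "H2T f" "i \<in> {1,2}" "j \<in> {1,2}"
  shows "square_integrable torus (d2 i j f)" "weak_pd i (pd j f) (d2 i j f)"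
proof -
  have "\<exists>g. L2T g \<and> weak_pd i (pd j f) g" using assms unfolding H2T_def by blast
  then have "L2T (d2 i j f) \<and> weak_pd i (pd j f) (d2 i j f)"
    unfolding d2_def pd_def[of i] by (rule someI_ex)
  then show "square_integrable torus (d2 i j f)" "weak_pd i (pd j f) (d2 i j f)"
    by (auto intro: L2T_square_integrable)
qed

lemma H2T_square_integrable: "H2T f \<Longrightarrow> square_integrable torus f"
  by (simp add: H2T_def L2T_square_integrable)

lemma ipT_pd:
  assumes "H2T f" "H2T g" "i \<in> {1,2}"
  shows "ipT f (pd i g) = - ipT (pd i f) g"
  by (rule weak_integration_by_parts[where i=i]) (use assms in \<open>auto intro: H2T_pd H2T_square_integrable\<close>)

text \<open>Only the outer derivative moves; the inner one stays on \<open>g\<close>, so the order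
  of the indices is preserved.\<close>

lemma ipT_d2:
  assumes "H2T f" "H2T g" "i \<in> {1,2}" "j \<in> {1,2}"
  shows "ipT f (d2 i j g) = - ipT (pd i f) (pd j g)"
  by (rule weak_integration_by_parts[where i=i])
     (use assms in \<open>auto intro: H2T_pd H2T_d2 H2T_square_integrable\<close>)

lemma H2T_operators_square_integrable:
  assumes "H2T f"
  shows "square_integrable torus (Dconv u1 u2 f)" "square_integrable torus (Dconv2 u1 u2 f)"
    "square_integrable torus (lapT f)" "square_integrable torus (numvisc dx1 dx2 u1 u2 f)"
  unfolding Dconv_def[abs_def] Dconv2_def[abs_def] lapT_def[abs_def] numvisc_def[abs_def]
  by (intro square_integrable_add square_integrable_cmult H2T_pd H2T_d2 assms; simp)+

lemmas H2T_simps = H2T_square_integrable H2T_pd(1) H2T_d2(1) H2T_operators_square_integrable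
  square_integrable_add square_integrable_diff square_integrable_cmult

lemma ipT_Dconv_self:
  assumes f: "H2T f"
  shows "ipT f (Dconv u1 u2 f) = 0"
proof -
  have "ipT f (pd 1 f) = 0" "ipT f (pd 2 f) = 0"
    using ipT_pd[OF f f, of 1] ipT_pd[OF f f, of 2] ipT_commute[of f "pd 1 f"] ipT_commute[of f "pd 2 f"]
    by simp_all
  then show ?thesis
    using f by (simp add: Dconv_def[abs_def] ipT_bilinear H2T_simps)
qed

lemma ipT_Dconv2:
  assumes f: "H2T f"
  shows "ipT f (Dconv2 u1 u2 f) = - ipT (Dconv u1 u2 f) (Dconv u1 u2 f)"
  using f unfolding Dconv_def[abs_def] Dconv2_def[abs_def]
  by (simp add: ipT_bilinear H2T_simps ipT_d2 algebra_simps)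

lemma ipT_lapT:
  assumes f: "H2T f"
  shows "ipT f (lapT f) = - (ipT (pd 1 f) (pd 1 f) + ipT (pd 2 f) (pd 2 f))"
  using f unfolding lapT_def[abs_def] by (simp add: ipT_bilinear H2T_simps ipT_d2)

lemma ipT_numvisc:
  assumes f: "H2T f"
  shows "ipT f (numvisc dx1 dx2 u1 u2 f)
    = - (1/2 * (dx1 * \<bar>u1\<bar> * ipT (pd 1 f) (pd 1 f) + dx2 * \<bar>u2\<bar> * ipT (pd 2 f) (pd 2 f)))"
  using f unfolding numvisc_def[abs_def]
  by (simp only: ipT_bilinear H2T_simps ipT_d2 insert_iff simp_thms) (simp add: algebra_simps)

text \<open>The convective derivative is the outer one here, so it moves to \<open>f\<close> as a
  whole and leaves the divergence intact.\<close>

lemma ipT_Dconv_div: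
  assumes "H2T f" "H2T v1" "H2T v2"
  shows "ipT f (\<lambda>x. u1 * (d2 1 1 v1 x + d2 1 2 v2 x) + u2 * (d2 2 1 v1 x + d2 2 2 v2 x))
    = - ipT (Dconv u1 u2 f) (\<lambda>x. pd 1 v1 x + pd 2 v2 x)"
  using assms unfolding Dconv_def[abs_def]
  by (simp add: ipT_bilinear H2T_simps ipT_d2 algebra_simps)

lemma ipT_Dconv_grad:
  assumes "H2T v" "H2T r" "m \<in> {1,2}"
  shows "ipT v (\<lambda>x. u1 * d2 1 m r x + u2 * d2 2 m r x) = - ipT (Dconv u1 u2 v) (pd m r)"
  using assms unfolding Dconv_def[abs_def]
  by (simp add: ipT_bilinear H2T_simps ipT_d2 algebra_simps)

text \<open>Here the gradient is outermost; summed over both velocity components, the right-hand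
  sides form minus the squared norm of the divergence.\<close>

lemma ipT_grad_div:
  assumes "H2T v" "H2T v1" "H2T v2" "m \<in> {1,2}"
  shows "ipT v (\<lambda>x. d2 m 1 v1 x + d2 m 2 v2 x) = - ipT (pd m v) (\<lambda>x. pd 1 v1 x + pd 2 v2 x)"
  using assms by (simp add: ipT_bilinear H2T_simps ipT_d2)

section \<open>Absorption into the numerical viscosity and the dissipation inequality\<close>

lemma numerical_viscosity_dominates:
  assumes f: "H2T f" and "B \<ge> 0" "dx1 > 0" "dx2 > 0" "dt > 0"
    and cfl1: "4 * B * \<bar>u1\<bar> * dt \<le> dx1" and cfl2: "4 * B * \<bar>u2\<bar> * dt \<le> dx2"
  shows "dt * B * ipT (Dconv u1 u2 f) (Dconv u1 u2 f)
     \<le> 1/2 * (dx1 * \<bar>u1\<bar> * ipT (pd 1 f) (pd 1 f) + dx2 * \<bar>u2\<bar> * ipT (pd 2 f) (pd 2 f))"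
proof -
  let ?X = "\<lambda>x. u1 * pd 1 f x" and ?Y = "\<lambda>x. u2 * pd 2 f x"
  let ?p = "ipT (pd 1 f) (pd 1 f)" and ?q = "ipT (pd 2 f) (pd 2 f)"
  \<comment> \<open>Nonnegativity of the squared norm of the difference of the two directional
    terms; it yields \<open>(X + Y)^2 \<le> 2 * (X^2 + Y^2)\<close>.\<close>
  have "0 \<le> 1 * ipT ?X ?X + (-2) * ipT ?X ?Y + 1 * ipT ?Y ?Y"
    by (rule ipT_quadratic_form_nonneg) (use f in \<open>simp_all add: H2T_simps\<close>)
  moreover have "ipT (Dconv u1 u2 f) (Dconv u1 u2 f) = ipT ?X ?X + 2 * ipT ?X ?Y + ipT ?Y ?Y"
    using f ipT_commute[of "pd 1 f" "pd 2 f"] unfolding Dconv_def[abs_def]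
    by (simp add: ipT_bilinear H2T_simps algebra_simps)
  ultimately have "ipT (Dconv u1 u2 f) (Dconv u1 u2 f) \<le> 2 * (ipT ?X ?X + ipT ?Y ?Y)"
    by (simp only: mult_minus_left mult_1) argo
  also have "\<dots> = 2 * (\<bar>u1\<bar> * \<bar>u1\<bar> * ?p + \<bar>u2\<bar> * \<bar>u2\<bar> * ?q)" by (simp add: ipT_bilinear)
  finally have "dt * B * ipT (Dconv u1 u2 f) (Dconv u1 u2 f)
      \<le> dt * B * (2 * (\<bar>u1\<bar> * \<bar>u1\<bar> * ?p + \<bar>u2\<bar> * \<bar>u2\<bar> * ?q))"
    using assms by (intro mult_left_mono) auto
  \<comment> \<open>The 2 from splitting the square and the factor 1/2 of the viscosity together
    account for the 4 in the step restriction.\<close>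
  also have "\<dots> = 1/2 * ((4 * B * \<bar>u1\<bar> * dt) * (\<bar>u1\<bar> * ?p) + (4 * B * \<bar>u2\<bar> * dt) * (\<bar>u2\<bar> * ?q))"
    by (simp add: algebra_simps)
  also have "\<dots> \<le> 1/2 * (dx1 * (\<bar>u1\<bar> * ?p) + dx2 * (\<bar>u2\<bar> * ?q))"
    using cfl1 cfl2 ipT_self_nonneg by (intro mult_left_mono add_mono mult_right_mono) auto
  finally show ?thesis by (simp add: mult.assoc)
qed

lemma modified_equation_dissipation:
  fixes rb a u1 u2 eps dt dx1 dx2 b1 b2 b3 :: real
  defines "K \<equiv> a\<^sup>2 / (rb * eps\<^sup>2)" and "\<beta> \<equiv> b2\<^sup>2 / (4 * b3)"
  assumes pos: "rb > 0" "eps > 0" "dx1 > 0" "dx2 > 0" "dt > 0" and a: "a > 0" and b1: "b1 < 0" and b3: "b3 > 0"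
    and cfl: "4 * (\<beta> - b1) * \<bar>u1\<bar> * dt \<le> dx1" "4 * (\<beta> - b1) * \<bar>u2\<bar> * dt \<le> dx2"
    and H: "H2T r" "H2T v1" "H2T v2" and Ht: "H2T rt" "H2T v1t" "H2T v2t"
    and eq: "AE x in lebesgue. x \<in> Tbox \<longrightarrow>
        modeq_at rb a u1 u2 eps dt dx1 dx2 b1 b2 b3 r v1 v2 rt v1t v2t x"
  shows "K * ipT r rt + rb * (ipT v1 v1t + ipT v2 v2t) \<le> 0"
proof -
  define dv where "dv = (\<lambda>x. pd 1 v1 x + pd 2 v2 x)"
  define Dr Dv1 Dv2 where "Dr = Dconv u1 u2 r" and "Dv1 = Dconv u1 u2 v1" and "Dv2 = Dconv u1 u2 v2"
  \<comment> \<open>From here on \<epsilon> enters only through \<open>K\<close>.\<close>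
  have A: "a\<^sup>2 / eps\<^sup>2 = K * rb" using pos by (simp add: K_def)
  have Kpos: "K > 0" using pos a by (simp add: K_def)
  have \<beta>: "\<beta> \<ge> 0" "4 * b3 * \<beta> = b2\<^sup>2" using b3 by (simp_all add: \<beta>_def)
  have eqs: "AE x in torus. 
     rt x = dt * (b1 * Dconv2 u1 u2 r x + b3 * (K * rb) * lapT r x) + numvisc dx1 dx2 u1 u2 r x
         + dt * rb * b2 * (u1 * (d2 1 1 v1 x + d2 1 2 v2 x) + u2 * (d2 2 1 v1 x + d2 2 2 v2 x))
         - Dconv u1 u2 r x - rb * (pd 1 v1 x + pd 2 v2 x)"
   "AE x in torus. 
     v1t x = dt * K * b2 * (u1 * d2 1 1 r x + u2 * d2 2 1 r x)
             + dt * (b1 * Dconv2 u1 u2 v1 x + b3 * (K * rb) * (d2 1 1 v1 x + d2 1 2 v2 x))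
             + numvisc dx1 dx2 u1 u2 v1 x - Dconv u1 u2 v1 x - K * pd 1 r x"
   "AE x in torus. 
     v2t x = dt * K * b2 * (u1 * d2 1 2 r x + u2 * d2 2 2 r x)
             + dt * (b1 * Dconv2 u1 u2 v2 x + b3 * (K * rb) * (d2 2 1 v1 x + d2 2 2 v2 x))
             + numvisc dx1 dx2 u1 u2 v2 x - Dconv u1 u2 v2 x - K * pd 2 r x"
    using eq unfolding AE_restrict_space_iff[of Tbox lebesgue, simplified]
      modeq_at_def Let_def K_def[symmetric] A by (eventually_elim, force)+
  note ip = ipT_add_right ipT_diff_right ipT_cmult_right H2T_simps insert_iff simp_thms
  have er: "ipT r rt = dt * (b1 * ipT r (Dconv2 u1 u2 r) + b3 * (K * rb) * ipT r (lapT r)) + ipT r (numvisc dx1 dx2 u1 u2 r)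
         + dt * rb * b2 * ipT r (\<lambda>x. u1 * (d2 1 1 v1 x + d2 1 2 v2 x) + u2 * (d2 2 1 v1 x + d2 2 2 v2 x))
         - ipT r (Dconv u1 u2 r) - rb * (ipT r (pd 1 v1) + ipT r (pd 2 v2))"
    by (subst ipT_cong_AE[OF _ _ _ eqs(1)]) (use H Ht in \<open>simp_all only: ip\<close>)
  have e1: "ipT v1 v1t = dt * K * b2 * ipT v1 (\<lambda>x. u1 * d2 1 1 r x + u2 * d2 2 1 r x)
             + dt * (b1 * ipT v1 (Dconv2 u1 u2 v1) + b3 * (K * rb) * ipT v1 (\<lambda>x. d2 1 1 v1 x + d2 1 2 v2 x))
             + ipT v1 (numvisc dx1 dx2 u1 u2 v1) - ipT v1 (Dconv u1 u2 v1) - K * ipT v1 (pd 1 r)"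
    by (subst ipT_cong_AE[OF _ _ _ eqs(2)]) (use H Ht in \<open>simp_all only: ip\<close>)
  have e2: "ipT v2 v2t = dt * K * b2 * ipT v2 (\<lambda>x. u1 * d2 1 2 r x + u2 * d2 2 2 r x)
             + dt * (b1 * ipT v2 (Dconv2 u1 u2 v2) + b3 * (K * rb) * ipT v2 (\<lambda>x. d2 2 1 v1 x + d2 2 2 v2 x))
             + ipT v2 (numvisc dx1 dx2 u1 u2 v2) - ipT v2 (Dconv u1 u2 v2) - K * ipT v2 (pd 2 r)"
    by (subst ipT_cong_AE[OF _ _ _ eqs(3)]) (use H Ht in \<open>simp_all only: ip\<close>)
  have dv: "ipT (pd 1 v1) dv + ipT (pd 2 v2) dv = ipT dv dv" and sdv: "square_integrable torus dv"
    using H ipT_add_left[of dv "pd 1 v1" "pd 2 v2"] by (simp_all add: dv_def H2T_simps)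
  \<comment> \<open>With weights \<open>K\<close> and \<open>rb\<close>, the pressure and divergence
    terms carry the same factor \<open>K * rb\<close> and cancel.\<close>
  have skew: "ipT v1 (pd 1 r) = - ipT r (pd 1 v1)" "ipT v2 (pd 2 r) = - ipT r (pd 2 v2)"
    using ipT_pd[of v1 r 1] ipT_pd[of v2 r 2] H ipT_commute[of r "pd 1 v1"] ipT_commute[of r "pd 2 v2"] by simp_all
  have sD: "square_integrable torus Dr" "square_integrable torus Dv1" "square_integrable torus Dv2"
    using H by (simp_all add: Dr_def Dv1_def Dv2_def H2T_simps)
  define N where "N = (\<lambda>f. 1/2 * (dx1 * \<bar>u1\<bar> * ipT (pd 1 f) (pd 1 f) + dx2 * \<bar>u2\<bar> * ipT (pd 2 f) (pd 2 f)))"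
  \<comment> \<open>The dissipation is used crosswise: that of the divergence, from the velocity
    equations, absorbs the mixed term of the density equation, and that of the density gradient
    absorbs those of the velocity equations.\<close>
  let ?Y0 = "\<beta> * ipT Dr Dr + rb * b2 * ipT Dr dv + rb\<^sup>2 * b3 * ipT dv dv"
  let ?Y1 = "\<beta> * ipT Dv1 Dv1 + K * b2 * ipT Dv1 (pd 1 r) + K\<^sup>2 * b3 * ipT (pd 1 r) (pd 1 r)"
  let ?Y2 = "\<beta> * ipT Dv2 Dv2 + K * b2 * ipT Dv2 (pd 2 r) + K\<^sup>2 * b3 * ipT (pd 2 r) (pd 2 r)"
  \<comment> \<open>\<beta> is chosen to make this an equality for every \<open>c\<close>. It is
    used with \<open>c = rb\<close> and \<open>c = K\<close>, so the cost \<beta> does not depend on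
    \<epsilon>.\<close>
  have disc: "(c * b2)\<^sup>2 \<le> 4 * \<beta> * (c\<^sup>2 * b3)" for c
    by (simp add: power_mult_distrib flip: \<beta>(2))
  have Y: "0 \<le> ?Y0" "0 \<le> ?Y1" "0 \<le> ?Y2"
    by (intro ipT_quadratic_form_nonneg sD sdv disc; use \<beta> b3 pos Kpos H in \<open>simp add: H2T_simps\<close>)+
  have "dt * (\<beta> - b1) * ipT (Dconv u1 u2 f) (Dconv u1 u2 f) \<le> N f" if "H2T f" for f
    unfolding N_def
    by (rule numerical_viscosity_dominates[OF that]) (use \<beta> b1 pos cfl in auto)
  then have Ns: "0 \<le> N r - dt * (\<beta> - b1) * ipT Dr Dr" "0 \<le> N v1 - dt * (\<beta> - b1) * ipT Dv1 Dv1"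
     "0 \<le> N v2 - dt * (\<beta> - b1) * ipT Dv2 Dv2"
    using H by (simp_all add: Dr_def Dv1_def Dv2_def)
  have one: "1 \<in> {1, 2::nat}" and two: "2 \<in> {1, 2::nat}" by simp_all
  note parts = ipT_Dconv2[OF H(1)] ipT_Dconv2[OF H(2)] ipT_Dconv2[OF H(3)] ipT_lapT[OF H(1)]
    ipT_numvisc[OF H(1)] ipT_numvisc[OF H(2)] ipT_numvisc[OF H(3)]
    ipT_Dconv_self[OF H(1)] ipT_Dconv_self[OF H(2)] ipT_Dconv_self[OF H(3)]
    ipT_Dconv_div[OF H] ipT_Dconv_grad[OF H(2,1) one] ipT_Dconv_grad[OF H(3,1) two]
    ipT_grad_div[OF H(2,2,3) one] ipT_grad_div[OF H(3,2,3) two]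
  \<comment> \<open>An exact identity: the \<beta> contributions of the Young forms cancel those
    subtracted from the viscosity, leaving the \<open>b1\<close> terms.\<close>
  have "- (K * ipT r rt + rb * (ipT v1 v1t + ipT v2 v2t))
     = dt * K * ?Y0 + dt * rb * (?Y1 + ?Y2) + K * (N r - dt * (\<beta> - b1) * ipT Dr Dr)
      + rb * ((N v1 - dt * (\<beta> - b1) * ipT Dv1 Dv1) + (N v2 - dt * (\<beta> - b1) * ipT Dv2 Dv2))"
    unfolding er e1 e2 skew dv[symmetric] parts dv_def[symmetric] N_def Dr_def Dv1_def Dv2_def by (simp add: power2_eq_square algebra_simps)
  also have "\<dots> \<ge> 0"
    using mult_nonneg_nonneg[OF _ Y(1), of "dt * K"]
      mult_nonneg_nonneg[OF _ add_nonneg_nonneg[OF Y(2,3)], of "dt * rb"]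
      mult_nonneg_nonneg[OF _ Ns(1), of K] mult_nonneg_nonneg[OF _ add_nonneg_nonneg[OF Ns(2,3)], of rb]
      pos Kpos
    by (intro add_nonneg_nonneg[OF add_nonneg_nonneg[OF add_nonneg_nonneg]]) (simp_all only: less_imp_le mult_nonneg_nonneg)
  finally show ?thesis by simp
qed

theorem mainTheorem6:
  fixes at21 a11 a21 a22 wt1 wt2 w1 w2 u1 u2 a :: real
  assumes first_order: "wt1 + wt2 = 1" "w1 + w2 = 1"
    and a_pos: "a > 0"
    and u_nz: "u1 \<noteq> 0" "u2 \<noteq> 0"
    and b1_neg: "imex_b1 at21 wt2 < 0"
    and b3_pos: "imex_b3 a11 a21 a22 w1 w2 > 0"
  shows "\<exists>C>0. \<forall>rb eps dx1 dx2 dt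
            (r :: real \<Rightarrow> real \<times> real \<Rightarrow> real) v1 v2 rt v1t v2t.
     rb > 0 \<longrightarrow> eps > 0 \<longrightarrow> dx1 > 0 \<longrightarrow> dx2 > 0 \<longrightarrow>
     0 < dt \<longrightarrow> dt \<le> C * min dx1 dx2 \<longrightarrow>
     C1_H2 r rt \<longrightarrow> C1_H2 v1 v1t \<longrightarrow> C1_H2 v2 v2t \<longrightarrow>
     (\<forall>t\<ge>0. AE x in lebesgue. x \<in> Tbox \<longrightarrow>
        modeq_at rb a u1 u2 eps dt dx1 dx2
          (imex_b1 at21 wt2) (imex_b2 at21 a11 a21 a22 wt1 wt2 w2) (imex_b3 a11 a21 a22 w1 w2)
          (r t) (v1 t) (v2 t) (rt t) (v1t t) (v2t t) x) \<longrightarrow>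
     (\<forall>t\<ge>0. \<exists>D. ((\<lambda>s. energy rb a eps (r s) (v1 s) (v2 s)) has_real_derivative D)
                   (at t within {0..}) \<and> D \<le> 0)"
proof -
  define b1 b2 b3 where "b1 = imex_b1 at21 wt2" and "b2 = imex_b2 at21 a11 a21 a22 wt1 wt2 w2"
    and "b3 = imex_b3 a11 a21 a22 w1 w2"
  have b: "b1 < 0" "b3 > 0" using b1_neg b3_pos by (simp_all add: b1_def b3_def)
  define B where "B = b2\<^sup>2 / (4 * b3) - b1"
  have B: "B > 0" using b by (simp add: B_def add_nonneg_pos diff_conv_add_uminus del: add_uminus_conv_diff)
  define U where "U = \<bar>u1\<bar> + \<bar>u2\<bar>"
  have U: "U > 0" using u_nz by (simp add: U_def)
  \<comment> \<open>\<open>U\<close> bounds the speed in both directions, so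
    \<open>4 * B * U * dt \<le> min dx1 dx2\<close> implies both step restrictions; \<open>B\<close>
    and \<open>U\<close> contain neither \<open>eps\<close> nor \<open>rb\<close>.\<close>
  define C where "C = 1 / (4 * B * U)"
  have C: "C > 0" using B U by (simp add: C_def)
  show ?thesis
    unfolding b1_def[symmetric] b2_def[symmetric] b3_def[symmetric]
  proof (rule exI[of _ C], intro conjI C allI impI)
    fix rb eps dx1 dx2 dt t :: real and r v1 v2 rt v1t v2t :: "real \<Rightarrow> real \<times> real \<Rightarrow> real"
    assume pos: "rb > 0" "eps > 0" "dx1 > 0" "dx2 > 0" "0 < dt" and dt: "dt \<le> C * min dx1 dx2"
      and H: "C1_H2 r rt" "C1_H2 v1 v1t" "C1_H2 v2 v2t"
      and eq: "\<forall>t\<ge>0. AE x in lebesgue. x \<in> Tbox \<longrightarrow>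
        modeq_at rb a u1 u2 eps dt dx1 dx2 b1 b2 b3 (r t) (v1 t) (v2 t) (rt t) (v1t t) (v2t t) x"
      and t: "t \<ge> 0"
    let ?K = "a\<^sup>2 / (rb * eps\<^sup>2)"
    have "4 * B * U * dt \<le> 4 * B * U * (C * min dx1 dx2)"
      using dt B U by (intro mult_left_mono) auto
    then have BU: "4 * B * U * dt \<le> min dx1 dx2" using B U by (simp add: C_def)
    have cfl: "4 * B * \<bar>u1\<bar> * dt \<le> dx1" "4 * B * \<bar>u2\<bar> * dt \<le> dx2"
    proof -
      have "4 * B * \<bar>u1\<bar> * dt \<le> 4 * B * U * dt" "4 * B * \<bar>u2\<bar> * dt \<le> 4 * B * U * dt"
        using B pos by (auto intro!: mult_right_mono mult_left_mono simp: U_def)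
      then show "4 * B * \<bar>u1\<bar> * dt \<le> dx1" "4 * B * \<bar>u2\<bar> * dt \<le> dx2" using BU by linarith+
    qed
    have C1: "C1_L2 r rt" "C1_L2 v1 v1t" "C1_L2 v2 v2t"
      and HT: "\<And>s. s \<ge> 0 \<Longrightarrow> H2T (r s)" "\<And>s. s \<ge> 0 \<Longrightarrow> H2T (v1 s)" "\<And>s. s \<ge> 0 \<Longrightarrow> H2T (v2 s)"
      "H2T (rt t)" "H2T (v1t t)" "H2T (v2t t)"
      using H t unfolding C1_H2_def by blast+
    have le: "?K * ipT (r t) (rt t) + rb * (ipT (v1 t) (v1t t) + ipT (v2 t) (v2t t)) \<le> 0"
      by (rule modified_equation_dissipation[where ?u1.0=u1 and ?u2.0=u2 and ?dx1.0=dx1 and ?dx2.0=dx2 and ?b1.0=b1 and ?b2.0=b2 and ?b3.0=b3])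
         (use pos a_pos b cfl HT eq t in \<open>auto simp: B_def\<close>)
    have "((\<lambda>s. ?K * intT (\<lambda>x. (r s x)\<^sup>2) + rb * (intT (\<lambda>x. (v1 s x)\<^sup>2) + intT (\<lambda>x. (v2 s x)\<^sup>2)))
        has_real_derivative (?K * (2 * ipT (r t) (rt t))
          + rb * (2 * ipT (v1 t) (v1t t) + 2 * ipT (v2 t) (v2t t)))) (at t within {0..})"
      unfolding ipT_def
      by (intro DERIV_add DERIV_cmult C1_L2_norm_derivative C1 t)
    then have "((\<lambda>s. energy rb a eps (r s) (v1 s) (v2 s)) has_real_derivative (?K * (2 * ipT (r t) (rt t))
          + rb * (2 * ipT (v1 t) (v1t t) + 2 * ipT (v2 t) (v2t t)))) (at t within {0..})"
    \<comment> \<open>The energy has one integral for both velocity components. Splitting it uses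
      their square integrability, available for times \<open>s \<ge> 0\<close>, hence the agreement
      only within \<open>{0..}\<close>.\<close>
    proof (rule has_field_derivative_transform_within[OF _ zero_less_one])
      show "?K * intT (\<lambda>x. (r s x)\<^sup>2)
          + rb * (intT (\<lambda>x. (v1 s x)\<^sup>2) + intT (\<lambda>x. (v2 s x)\<^sup>2))
          = energy rb a eps (r s) (v1 s) (v2 s)" if "s \<in> {0..}" for s
        using HT(2,3)[of s] that
        by (simp add: energy_def intT_eq H2T_square_integrable[unfolded square_integrable_def])
    qed (use t in auto)
    then show "\<exists>D. ((\<lambda>s. energy rb a eps (r s) (v1 s) (v2 s)) has_real_derivative D)
                   (at t within {0..}) \<and> D \<le> 0"
      using le by (intro exI conjI) (assumption, simp add: algebra_simps)
  qed
qed

end
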